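(* Let $M$ be a (nonempty) compact metric space, $X=(X,\lVert\cdot\rVert)$ a separable Banach space, $\Phi=(\phi_t)_{t\ge0}$ a semi-flow on $M$, and $\mathcal{A}\colon M\times[0,\infty)\to B(X)$ a continuous cocycle over $\Phi$. Then the following properties are equivalent: (1) there exist a Borel-measurable function $C\colon M\to(0,\infty)$, a full-measure set $E\subset M$ and $p>0$ such that \[ \bigg(\int_0^\infty\lVert\mathcal{A}(q,t)x\rVert^p\,dt\bigg)^{1/p}\le C(q)\lVert x\rVert \] for each $q\in E$ and $x\in X$; (2) $\mathcal{A}$ is uniformly exponentially stable, i.e. there exist $D,\lambda>0$ such that \[ \lVert\mathcal{A}(q,t)\rVert\le De^{-\lambda t}\quad\text{for every }q\in M\text{ and }t\ge0. \]
   Context: $B(X)$ is the space of all bounded linear operators on $X$. A family of maps $\Phi=(\phi_t)_{t\ge0}$, $\phi_t\colon M\to M$, is a semi-flow if: each $\phi_t$ is continuous; $\phi_0=\mathrm{Id}$; $\phi_{t+s}=\phi_t\circ\phi_s$ for $t,s\ge0$; and $(q,t)\mapsto\phi_t(q)$ is continuous on $M\times[0,\infty)$. A map $\mathcal{A}\colon M\times[0,\infty)\to B(X)$ is a cocycle over $\Phi$ if: (i) $\mathcal{A}(q,0)=\mathrm{Id}$ for $q\in M$; (ii) $\mathcal{A}(q,t+s)=\mathcal{A}(\phi_s(q),t)\mathcal{A}(q,s)$ for $q\in M$ and $t,s\ge0$; (iii) $(q,t)\mapsto\mathcal{A}(q,t)x$ is continuous on $M\times[0,\infty)$ for each $x\in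 X$. The cocycle is called continuous if $\mathcal{A}\colon M\times[0,\infty)\to B(X)$ is a continuous map with respect to the operator norm on $B(X)$. Let $\mathcal{E}(\Phi)$ denote the set of all ergodic $\Phi$-invariant Borel probability measures on $M$. A Borel subset $E\subset M$ has full-measure if $\mu(E)=1$ for every $\mu\in\mathcal{E}(\Phi)$. *)

theory Defs
  imports "HOL-Probability.Probability"
begin

text \<open>
  A semi-flow acts on a whole type, which plays the role of the phase space. Time is
  represented by reals; only times \<open>t \<ge> 0\<close> are constrained, and values at negative
  times are irrelevant.
\<close>

definition semiflow :: "(real \<Rightarrow> 'm::metric_space \<Rightarrow> 'm) \<Rightarrow> bool" where
  "semiflow \<phi> \<longleftrightarrow>
     (\<forall>t\<ge>0. continuous_on UNIV (\<phi> t)) \<and>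
     \<phi> 0 = id \<and>
     (\<forall>t\<ge>0. \<forall>s\<ge>0. \<phi> (t + s) = \<phi> t \<circ> \<phi> s) \<and>
     continuous_on (UNIV \<times> {0..}) (\<lambda>(q, t). \<phi> t q)"

definition cocycle ::
  "(real \<Rightarrow> 'm::metric_space \<Rightarrow> 'm) \<Rightarrow> ('m \<Rightarrow> real \<Rightarrow> ('x::real_normed_vector \<Rightarrow>\<^sub>L 'x)) \<Rightarrow> bool" where
  "cocycle \<phi> A \<longleftrightarrow>
     (\<forall>q. A q 0 = id_blinfun) \<and>
     (\<forall>q. \<forall>t\<ge>0. \<forall>s\<ge>0. A q (t + s) = A (\<phi> s q) t o\<^sub>L A q s) \<and>
     (\<forall>x. continuous_on (UNIV \<times> {0..}) (\<lambda>(q, t). blinfun_apply (A q t) x))"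

text \<open>The topology on bounded linear operators is that of the operator norm.\<close>

definition continuous_cocycle ::
  "(real \<Rightarrow> 'm::metric_space \<Rightarrow> 'm) \<Rightarrow> ('m \<Rightarrow> real \<Rightarrow> ('x::real_normed_vector \<Rightarrow>\<^sub>L 'x)) \<Rightarrow> bool" where
  "continuous_cocycle \<phi> A \<longleftrightarrow>
     cocycle \<phi> A \<and> continuous_on (UNIV \<times> {0..}) (\<lambda>(q, t). A q t)"

definition invariant_prob_measure ::
  "(real \<Rightarrow> 'm::metric_space \<Rightarrow> 'm) \<Rightarrow> 'm measure \<Rightarrow> bool" where
  "invariant_prob_measure \<phi> \<mu> \<longleftrightarrow>
     prob_space \<mu> \<and> sets \<mu> = sets borel \<and>
     (\<forall>t\<ge>0. \<forall>B\<in>sets borel. emeasure \<mu> (\<phi> t -` B) = emeasure \<mu> B)"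

text \<open>
  Ergodicity is triviality of the invariant Borel sets, i.e. those with \<open>\<phi> t -` B = B\<close>
  for every \<open>t \<ge> 0\<close>.
\<close>

definition ergodic_measures ::
  "(real \<Rightarrow> 'm::metric_space \<Rightarrow> 'm) \<Rightarrow> 'm measure set" where
  "ergodic_measures \<phi> =
     {\<mu>. invariant_prob_measure \<phi> \<mu> \<and>
         (\<forall>B\<in>sets borel. (\<forall>t\<ge>0. \<phi> t -` B = B) \<longrightarrow> emeasure \<mu> B = 0 \<or> emeasure \<mu> B = 1)}"

definition full_measure :: "(real \<Rightarrow> 'm::metric_space \<Rightarrow> 'm) \<Rightarrow> 'm set \<Rightarrow> bool" where
  "full_measure \<phi> E \<longleftrightarrow>
     E \<in> sets borel \<and> (\<forall>\<mu>\<in>ergodic_measures \<phi>. emeasure \<mu> E = 1)"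

definition uniformly_exp_stable ::
  "('m \<Rightarrow> real \<Rightarrow> ('x::real_normed_vector \<Rightarrow>\<^sub>L 'x)) \<Rightarrow> bool" where
  "uniformly_exp_stable A \<longleftrightarrow>
     (\<exists>D>0. \<exists>r>0. \<forall>q. \<forall>t\<ge>0. norm (A q t) \<le> D * exp (- r * t))"

end

theory Submission
  imports Defs "HOL-Real_Asymp.Real_Asymp"
begin

text \<open>
  Suppose the cocycle is not uniformly exponentially stable and put
  \<open>g t q = ln (max \<parallel>A q t\<parallel> (exp (- t)))\<close>, a continuous subadditive family. Then
  \<open>g n\<close> is nonnegative somewhere for every \<open>n \<ge> 1\<close>. Let \<open>\<beta> \<ge> 0\<close> be the infimum of
  \<open>(SUP q. g n q) / n\<close>. Time averages along orbit segments realising the suprema have a weak limit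
  in the set of invariant measures with \<open>\<integral> g n d\<mu> \<ge> n \<beta>\<close> for all \<open>n\<close>. This set is weakly closed and
  a face of the set of invariant measures, so an extreme point of it is an ergodic measure \<open>\<mu>\<close> with
  \<open>\<integral> g n d\<mu> \<ge> 0\<close> for all \<open>n\<close>.

  On the other hand, \<open>\<mu>\<close>-almost every orbit stays in \<open>E\<close> at integer times, and there Datko's
  argument gives \<open>ln \<parallel>A q n\<parallel> \<le> b q - (\<Sum>j<n. w (\<phi> j q))\<close> with measurable \<open>b \<ge> 0\<close> and \<open>w > 0\<close>
  built from \<open>C\<close>. Integrating and dividing by \<open>n\<close> yields \<open>\<integral> w d\<mu> \<le> 0\<close> in the limit,
  a contradiction.
\<close>

section \<open>Weak compactness of Borel probability measures\<close>

text \<open>The bound \<open>C\<close> is merely measurable and is given only on \<open>E\<close>,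
  so compactness does not turn it into a uniform estimate; it is tested against an invariant measure
  instead. That measure has to be ergodic, since \<open>full_measure\<close> is stated for ergodic
  measures alone. This is why the maximal rate \<beta> appears and not 0: the invariant measures
  with \<open>\<integral> g n d\<mu> \<ge> 0\<close> for all \<open>n\<close> form a closed convex
  set, but in a mixture one component may compensate for a negative one, so an extreme point of that
  set need not be ergodic. At the maximal rate no component can compensate. The function
  \<open>b\<close> contains \<open>ln C\<close>, which need not be integrable. Its inequality is
  therefore combined with the trivial linear bound on \<open>g n\<close>; after division by
  \<open>n\<close> the minimum of the two is bounded and tends to 0 pointwise. The weight
  \<open>w\<close> is capped at 1, which makes it integrable and matches the floor
  \<open>exp (- n)\<close> inside \<open>g n\<close>; its strict positivity gives the
  contradiction.\<close>

lemma compact_UNIV_dense_sequence: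
  assumes "compact (UNIV :: 'm::metric_space set)"
  obtains c :: "nat \<Rightarrow> 'm::metric_space" where "\<And>e. e > 0 \<Longrightarrow> \<exists>n. \<forall>q. \<exists>i<n. dist (c i) q < e"
proof -
  have "\<exists>F. finite F \<and> UNIV \<subseteq> (\<Union>x\<in>F. ball x (1 / real (Suc k)) :: 'm set)" for k
    using seq_compact_imp_totally_bounded[of "UNIV :: 'm set"] assms compact_imp_seq_compact
    by (metis of_nat_0_less_iff zero_less_Suc zero_less_divide_1_iff)
  then obtain F :: "nat \<Rightarrow> 'm set" where F: "\<And>k. finite (F k)"
    "\<And>k. UNIV \<subseteq> (\<Union>x\<in>F k. ball x (1 / real (Suc k)))" by metis
  define D where "D = (\<Union>k. F k)"
  have "countable D" unfolding D_def using F(1) by (auto intro: countable_finite)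
  moreover have "D \<noteq> {}" using F(2)[of 0] unfolding D_def by blast
  ultimately have c: "range (from_nat_into D) = D" by (rule range_from_nat_into[rotated])
  show thesis
  proof (rule that[of "from_nat_into D"])
    fix e :: real assume "e > 0"
    then obtain k where k: "1 / real (Suc k) < e" using nat_approx_posE by blast
    have "\<exists>i. from_nat_into D i = x" if "x \<in> F k" for x
    proof -
      have "x \<in> range (from_nat_into D)" using that c unfolding D_def by blast
      then show ?thesis by auto
    qed
    then obtain g where g: "\<And>x. x \<in> F k \<Longrightarrow> from_nat_into D (g x) = x" by metis
    show "\<exists>n. \<forall>q. \<exists>i<n. dist (from_nat_into D i) q < e"
    proof (rule exI[of _ "Suc (Max (g ` F k))"], rule allI)
      fix q
      have "q \<in> (\<Union>x\<in>F k. ball x (1 / real (Suc k)))" using F(2) by blast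
      then obtain x where x: "x \<in> F k" "dist x q < 1 / real (Suc k)" by (auto simp del: of_nat_Suc)
      then have "g x < Suc (Max (g ` F k))" using F(1) by (simp add: less_Suc_eq_le)
      with x g k show "\<exists>i<Suc (Max (g ` F k)). dist (from_nat_into D i) q < e"
        by (metis order_less_trans)
    qed
  qed
qed

section \<open>Codes in the Cantor set\<close>

text \<open>Membership in \<open>B i\<close> is recorded as a ternary digit 0 or 2. Skipping the
  digit 1 leaves the gaps of the Cantor set, so digits can be read off from an approximate
  code.\<close>

definition cantor_code :: "(nat \<Rightarrow> 'a set) \<Rightarrow> 'a \<Rightarrow> real" where
  "cantor_code B q = (\<Sum>i. 2 * indicator (B i) q / 3 ^ Suc i)"

lemma cantor_code_tail:
  "(\<lambda>j. 2 / 3 ^ Suc (j + k)) sums (1 / 3 ^ k :: real)"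
proof -
  have "(\<lambda>j. 2 / 3 ^ Suc k * (1 / 3) ^ j) sums (2 / 3 ^ Suc k * (1 / (1 - 1 / 3)) :: real)"
    by (intro sums_mult geometric_sums) auto
  then show ?thesis by (simp add: power_add power_divide field_simps)
qed

lemma cantor_code_summable: "summable (\<lambda>i. 2 * indicator (B i) q / 3 ^ Suc i :: real)"
  by (rule summable_comparison_test'[OF sums_summable[OF cantor_code_tail[of 0]]])
     (auto simp: indicator_def)

lemma cantor_code_bounds: "0 \<le> cantor_code B q" "cantor_code B q \<le> 1"
proof -
  show "0 \<le> cantor_code B q" unfolding cantor_code_def
    by (intro suminf_nonneg cantor_code_summable) auto
  have "cantor_code B q \<le> (\<Sum>i. 2 / 3 ^ Suc (i + 0))" unfolding cantor_code_def
    by (intro suminf_le cantor_code_summable sums_summable[OF cantor_code_tail])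
       (auto simp: indicator_def)
  then show "cantor_code B q \<le> 1" using sums_unique[OF cantor_code_tail[of 0]] by simp
qed

text \<open>At the first index \<open>m\<close> where the digits differ they contribute a difference
  of \<open>2 / 3 ^ Suc m\<close>, while all later digits together can cancel at most half of
  it.\<close>

lemma cantor_code_close_imp_agree:
  assumes "\<bar>cantor_code B q - cantor_code B q'\<bar> < 1 / 3 ^ n" "i < n"
  shows "q \<in> B i \<longleftrightarrow> q' \<in> B i"
proof (rule ccontr)
  assume neq: "\<not> ?thesis"
  define P where "P j \<longleftrightarrow> \<not> (q \<in> B j \<longleftrightarrow> q' \<in> B j)" for j
  define m where "m = (LEAST j. P j)"
  have "P i" using neq by (simp add: P_def)
  then have "P m" "m \<le> i" unfolding m_def by (auto intro: LeastI Least_le)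
  then have m: "P m" "m < n" "\<And>j. j < m \<Longrightarrow> \<not> P j"
    using \<open>i < n\<close> not_less_Least[of _ P] unfolding m_def by (blast, linarith, blast)
  define d :: "nat \<Rightarrow> real" where "d j = 2 * indicator (B j) q / 3 ^ Suc j - 2 * indicator (B j) q' / 3 ^ Suc j" for j
  have sd: "summable d" unfolding d_def by (intro summable_diff cantor_code_summable)
  have "cantor_code B q - cantor_code B q' = suminf d"
    unfolding cantor_code_def d_def by (intro suminf_diff cantor_code_summable)
  also have "\<dots> = (\<Sum>j. d (j + Suc m)) + (\<Sum>j<Suc m. d j)"
    by (rule suminf_split_initial_segment[OF sd])
  also have "(\<Sum>j<Suc m. d j) = d m"
    using m(3) by (auto simp: d_def P_def indicator_def intro!: sum.neutral)
  finally have eq: "cantor_code B q - cantor_code B q' = (\<Sum>j. d (j + Suc m)) + d m" .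
  have dle: "\<bar>d j\<bar> \<le> 2 / 3 ^ Suc j" for j by (auto simp: d_def indicator_def)
  have s2: "summable (\<lambda>j. \<bar>d (j + Suc m)\<bar>)"
    by (rule summable_comparison_test'[OF sums_summable[OF cantor_code_tail[of "Suc m"]]])
       (simp only: real_norm_def abs_abs dle)
  have "\<bar>\<Sum>j. d (j + Suc m)\<bar> \<le> (\<Sum>j. \<bar>d (j + Suc m)\<bar>)" by (rule summable_rabs[OF s2])
  also have "\<dots> \<le> (\<Sum>j. 2 / 3 ^ Suc (j + Suc m))"
    by (intro suminf_le s2 sums_summable[OF cantor_code_tail] dle)
  also have "\<dots> = 1 / 3 ^ Suc m" using sums_unique[OF cantor_code_tail[of "Suc m"]] by simp
  finally have "\<bar>\<Sum>j. d (j + Suc m)\<bar> \<le> 1 / 3 ^ Suc m" .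
  moreover have "\<bar>d m\<bar> = 2 / 3 ^ Suc m" using m(1) by (auto simp: d_def P_def indicator_def)
  ultimately have "1 / 3 ^ Suc m \<le> \<bar>cantor_code B q - cantor_code B q'\<bar>" unfolding eq by linarith
  moreover have "1 / 3 ^ n \<le> (1 / 3 ^ Suc m :: real)"
    using m(2) by (intro divide_left_mono power_increasing) auto
  ultimately show False using assms(1) by linarith
qed

section \<open>Weak convergence of probability measures\<close>

definition borel_probs :: "'m::topological_space measure set" where
  "borel_probs = {\<mu>. prob_space \<mu> \<and> sets \<mu> = sets borel}"

text \<open>On a compact space every continuous function is bounded, so for probability measures
  this is the usual weak convergence.\<close>

definition weak_limit :: "(nat \<Rightarrow> 'm::topological_space measure) \<Rightarrow> 'm measure \<Rightarrow> bool" where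
  "weak_limit \<mu>s \<mu> \<longleftrightarrow> (\<forall>f :: 'm \<Rightarrow> real. continuous_on UNIV f \<longrightarrow>
     (\<lambda>k. integral\<^sup>L (\<mu>s k) f) \<longlonglongrightarrow> integral\<^sup>L \<mu> f)"

lemma borel_probsD:
  assumes "\<mu> \<in> borel_probs"
  shows "prob_space \<mu>" "sets \<mu> = sets borel" "space \<mu> = UNIV"
  using assms sets_eq_imp_space_eq[of \<mu> borel] by (auto simp: borel_probs_def)

lemma compact_UNIV_bounded:
  fixes f :: "'m::metric_space \<Rightarrow> real"
  assumes "compact (UNIV :: 'm set)" "continuous_on UNIV f"
  obtains K where "K \<ge> 0" "\<And>q. \<bar>f q\<bar> \<le> K"
proof -
  have "bounded (range f)" using assms compact_continuous_image compact_imp_bounded by blast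
  then obtain K where "\<And>q. \<bar>f q\<bar> \<le> K" by (auto simp: bounded_iff)
  then show thesis using that abs_ge_zero order_trans by blast
qed

lemma measurable_borel_probs:
  fixes f :: "'m::metric_space \<Rightarrow> 'b::topological_space"
  assumes "\<mu> \<in> borel_probs" "continuous_on UNIV f"
  shows "f \<in> borel_measurable \<mu>"
  using borel_measurable_continuous_onI[OF assms(2)] borel_probsD(2)[OF assms(1)]
    measurable_cong_sets by blast

lemma integrable_borel_probs:
  fixes f :: "'m::metric_space \<Rightarrow> real"
  assumes "compact (UNIV :: 'm set)" "\<mu> \<in> borel_probs" "continuous_on UNIV f"
  shows "integrable \<mu> f"
proof -
  interpret prob_space \<mu> using assms borel_probsD by auto
  obtain K where "\<And>q. \<bar>f q\<bar> \<le> K" using compact_UNIV_bounded[OF assms(1,3)] by metis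
  then show ?thesis
    by (intro integrable_const_bound[of _ K]) (auto intro: measurable_borel_probs[OF assms(2,3)])
qed

text \<open>
  Via a Borel code \<open>s\<close> into the Cantor set, whose inverse is uniformly continuous,
  this is Helly's selection theorem on the line.
\<close>

theorem borel_probs_weakly_compact:
  fixes \<mu>s :: "nat \<Rightarrow> 'm::metric_space measure"
  assumes comp: "compact (UNIV :: 'm set)" and \<mu>s: "\<And>k. \<mu>s k \<in> borel_probs"
  obtains r \<mu> where "strict_mono r" "\<mu> \<in> borel_probs" "weak_limit (\<mu>s \<circ> r) \<mu>"
proof -
  obtain c :: "nat \<Rightarrow> 'm" where c: "\<And>e. e > 0 \<Longrightarrow> \<exists>n. \<forall>q. \<exists>i<n. dist (c i) q < e"
    using compact_UNIV_dense_sequence[OF comp] by blast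
  \<comment> \<open>Every ball of radius \<open>1 / Suc k\<close> about a point of the sequence
    \<open>c\<close> gets an index, so the digits of \<open>s q\<close> locate \<open>q\<close> to
    any precision.\<close>
  define B where "B i = (case prod_decode i of (j, k) \<Rightarrow> ball (c j) (1 / real (Suc k)))" for i
  define s where "s = cantor_code B"
  have Bm[measurable]: "B i \<in> sets borel" for i unfolding B_def by (auto split: prod.split)
  have sm: "s \<in> borel_measurable borel" unfolding s_def cantor_code_def by measurable
  have mod: "\<exists>\<delta>>0. \<forall>q q'. \<bar>s q - s q'\<bar> < \<delta> \<longrightarrow> dist q q' < e" if "e > 0" for e
  proof -
    obtain k where k: "1 / real (Suc k) < e / 2" using nat_approx_posE \<open>e > 0\<close> half_gt_zero by blast
    obtain N where N: "\<And>q. \<exists>i<N. dist (c i) q < 1 / real (Suc k)"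
      using c[of "1 / real (Suc k)"] by auto
    \<comment> \<open>\<open>n\<close> exceeds the indices of all balls of radius
      \<open>1 / Suc k\<close> about the first \<open>N\<close> centres, so codes closer than
      \<open>1 / 3 ^ n\<close> agree on this whole net.\<close>
    define n where "n = Suc (Max ((\<lambda>i. prod_encode (i, k)) ` {..<N}))"
    have "dist q q' < e" if "\<bar>s q - s q'\<bar> < 1 / 3 ^ n" for q q'
    proof -
      obtain i where i: "i < N" "dist (c i) q < 1 / real (Suc k)" using N by blast
      have "prod_encode (i, k) < n" unfolding n_def less_Suc_eq_le using i(1) by (intro Max_ge) auto
      with that have "q \<in> B (prod_encode (i, k)) \<longleftrightarrow> q' \<in> B (prod_encode (i, k))"
        unfolding s_def by (intro cantor_code_close_imp_agree) auto
      then have "dist (c i) q' < 1 / real (Suc k)" using i by (simp add: B_def)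
      with i k show ?thesis by (smt (verit) dist_commute dist_triangle field_sum_of_halves)
    qed
    then show ?thesis by (intro exI[of _ "1 / 3 ^ n"]) auto
  qed
  \<comment> \<open>\<open>s\<close> is Borel but in general not continuous, so its range need not
    be closed. A limit of the laws of \<open>s\<close> is only known to live on the closure, hence
    the inverse of \<open>s\<close> is extended to \<open>K\<close>; compactness of the space
    supplies the values.\<close>
  define K where "K = closure (range s)"
  have "\<exists>q. \<exists>qs. (\<lambda>k. s (qs k)) \<longlonglongrightarrow> u \<and> qs \<longlonglongrightarrow> q" if "u \<in> K" for u
  proof -
    obtain us where us: "\<And>n. us n \<in> range s" "us \<longlonglongrightarrow> u"
      using \<open>u \<in> K\<close> unfolding K_def closure_sequential by blast
    then have "\<forall>n. \<exists>q. us n = s q" by auto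
    then obtain qs where qs: "\<And>n. us n = s (qs n)" by metis
    obtain r q where r: "strict_mono r" "(qs \<circ> r) \<longlonglongrightarrow> q"
      using comp unfolding compact_def by blast
    have "(\<lambda>k. s ((qs \<circ> r) k)) \<longlonglongrightarrow> u"
      using LIMSEQ_subseq_LIMSEQ[OF us(2) r(1)] by (simp add: o_def qs)
    then show ?thesis using r by blast
  qed
  then obtain \<pi> where \<pi>: "\<And>u. u \<in> K \<Longrightarrow> \<exists>qs. (\<lambda>k. s (qs k)) \<longlonglongrightarrow> u \<and> qs \<longlonglongrightarrow> \<pi> u" by metis
  \<comment> \<open>This one estimate yields both that \<open>\<pi>\<close> inverts \<open>s\<close>
    and that \<open>\<pi>\<close> is continuous on \<open>K\<close>.\<close>
  have near: "\<exists>\<delta>>0. \<forall>u\<in>K. \<forall>q. \<bar>s q - u\<bar> < \<delta> \<longrightarrow> dist q (\<pi> u) < e" if "e > 0" for e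
  proof -
    obtain \<delta> where \<delta>: "\<delta> > 0" "\<And>q q'. \<bar>s q - s q'\<bar> < \<delta> \<Longrightarrow> dist q q' < e / 2"
      using mod[of "e / 2"] \<open>e > 0\<close> by auto
    have "dist q (\<pi> u) < e" if u: "u \<in> K" "\<bar>s q - u\<bar> < \<delta>" for q u
    proof -
      obtain qs where qs: "(\<lambda>k. s (qs k)) \<longlonglongrightarrow> u" "qs \<longlonglongrightarrow> \<pi> u" using \<pi>[OF u(1)] by blast
      have "(\<lambda>k. \<bar>s q - s (qs k)\<bar>) \<longlonglongrightarrow> \<bar>s q - u\<bar>" by (intro tendsto_intros qs)
      then have "eventually (\<lambda>k. \<bar>s q - s (qs k)\<bar> < \<delta>) sequentially"
        using u(2) by (rule order_tendstoD)
      then have ev: "eventually (\<lambda>k. dist q (qs k) \<le> e / 2) sequentially"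
        by eventually_elim (use \<delta>(2) in force)
      have "(\<lambda>k. dist q (qs k)) \<longlonglongrightarrow> dist q (\<pi> u)" by (intro tendsto_intros qs)
      then have "dist q (\<pi> u) \<le> e / 2" using ev by (intro tendsto_upperbound) auto
      with \<open>e > 0\<close> show ?thesis by linarith
    qed
    with \<delta>(1) show ?thesis by blast
  qed
  have sK: "s q \<in> K" for q unfolding K_def using closure_subset[of "range s"] by auto
  have \<pi>s: "\<pi> (s q) = q" for q
  proof (rule ccontr)
    assume "\<pi> (s q) \<noteq> q"
    then have "dist q (\<pi> (s q)) > 0" by simp
    from near[OF this] obtain \<delta> where "\<delta> > 0"
      "\<And>u q'. u \<in> K \<Longrightarrow> \<bar>s q' - u\<bar> < \<delta> \<Longrightarrow> dist q' (\<pi> u) < dist q (\<pi> (s q))" by blast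
    from this(2)[of "s q" q] this(1) sK show False by simp
  qed
  have \<pi>cont: "continuous_on K \<pi>"
    unfolding continuous_on_iff
  proof (intro ballI allI impI)
    fix u and e :: real assume u: "u \<in> K" and e: "e > 0"
    obtain \<delta> where \<delta>: "\<delta> > 0" "\<And>u q. u \<in> K \<Longrightarrow> \<bar>s q - u\<bar> < \<delta> \<Longrightarrow> dist q (\<pi> u) < e / 2"
      using near[of "e / 2"] e by auto
    show "\<exists>d>0. \<forall>x'\<in>K. dist x' u < d \<longrightarrow> dist (\<pi> x') (\<pi> u) < e"
    proof (intro exI[of _ "\<delta> / 2"] conjI ballI impI)
      fix u' assume u': "u' \<in> K" "dist u' u < \<delta> / 2"
      obtain q where q: "\<bar>s q - u'\<bar> < \<delta> / 2"
        using u'(1) half_gt_zero[OF \<delta>(1)] unfolding K_def closure_approachable dist_real_def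
        by blast
      then have "\<bar>s q - u'\<bar> < \<delta>" "\<bar>s q - u\<bar> < \<delta>" using u'(2) unfolding dist_real_def by linarith+
      then have "dist q (\<pi> u') < e / 2" "dist q (\<pi> u) < e / 2" using \<delta>(2) u u' by auto
      then show "dist (\<pi> u') (\<pi> u) < e"
        by (metis dist_commute dist_triangle_half_r)
    qed (use \<delta> in auto)
  qed
  have Kc: "closed K" unfolding K_def by simp
  define \<nu>s where "\<nu>s k = distr (\<mu>s k) borel s" for k
  have smk: "s \<in> borel_measurable (\<mu>s k)" for k
    using sm borel_probsD(2)[OF \<mu>s] measurable_cong_sets by blast
  have rd: "real_distribution (\<nu>s k)" for k
    unfolding \<nu>s_def using borel_probsD[OF \<mu>s] smk by (intro prob_space.real_distribution_distr) auto
  have "tight \<nu>s"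
    unfolding tight_def
  proof (intro conjI allI impI rd)
    fix \<epsilon> :: real assume "\<epsilon> > 0"
    \<comment> \<open>Codes lie in \<open>{0..1}\<close>; the left end is moved to -1 because the
      interval is open there and the code 0 may occur.\<close>
    have "measure (\<nu>s k) {-1<..1} = 1" for k
    proof -
      interpret prob_space "\<mu>s k" by (rule borel_probsD(1)[OF \<mu>s])
      have "-1 < s q \<and> s q \<le> 1" for q
        using cantor_code_bounds[of B q] unfolding s_def by linarith
      then have "s -` {-1<..1} \<inter> space (\<mu>s k) = space (\<mu>s k)" by auto
      then show ?thesis unfolding \<nu>s_def using smk[of k] by (simp add: measure_distr prob_space)
    qed
    then show "\<exists>a b. a < b \<and> (\<forall>n. 1 - \<epsilon> < measure (\<nu>s n) {a<..b})"
      using \<open>\<epsilon> > 0\<close> by (intro exI[of _ "-1"] exI[of _ 1]) auto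
  qed
  then obtain r \<nu> where r: "strict_mono r" and \<nu>: "real_distribution \<nu>"
    and "weak_conv_m (\<nu>s \<circ> id \<circ> r) \<nu>"
    using tight_imp_convergent_subsubsequence[of \<nu>s id] strict_mono_id by blast
  then have wc: "weak_conv_m (\<lambda>k. \<nu>s (r k)) \<nu>" by (simp add: o_def)
  interpret \<nu>: real_distribution \<nu> by fact
  have conv: "(\<lambda>k. integral\<^sup>L (\<mu>s (r k)) (\<lambda>q. F (s q))) \<longlonglongrightarrow> integral\<^sup>L \<nu> F"
    if F: "continuous_on UNIV F" "\<And>x. \<bar>F x\<bar> \<le> b" for F :: "real \<Rightarrow> real" and b
  proof -
    have "(\<lambda>k. integral\<^sup>L (\<nu>s (r k)) F) \<longlonglongrightarrow> integral\<^sup>L \<nu> F"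
      using F wc rd \<nu> continuous_on_eq_continuous_at[of UNIV F]
      by (intro weak_conv_imp_integral_bdd_continuous_conv[where B = b]) auto
    moreover have "integral\<^sup>L (\<nu>s (r k)) F = integral\<^sup>L (\<mu>s (r k)) (\<lambda>q. F (s q))" for k
      unfolding \<nu>s_def using smk borel_measurable_continuous_onI[OF F(1)]
      by (intro integral_distr)
    ultimately show ?thesis by simp
  qed
  \<comment> \<open>The test function is continuous, bounded and zero exactly on the closed set
    \<open>K\<close>. Its integrals along the sequence vanish, hence so does its integral against
    \<open>\<nu>\<close>.\<close>
  have "AE u in \<nu>. u \<in> K"
  proof -
    let ?F = "\<lambda>u. min 1 (infdist u K)"
    have Fc: "continuous_on UNIV ?F" by (intro continuous_intros)
    have Fb: "\<bar>?F u\<bar> \<le> 1" for u using infdist_nonneg[of u K] by auto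
    have "?F (s q) = 0" for q using sK by simp
    then have "integral\<^sup>L \<nu> ?F = 0"
      using LIMSEQ_unique[OF conv[OF Fc Fb]] by (simp add: tendsto_const)
    moreover have "integrable \<nu> ?F"
      using Fb borel_measurable_continuous_onI[OF Fc]
      by (intro \<nu>.integrable_const_bound[of _ 1]) (auto simp: measurable_cong_sets[OF \<nu>.events_eq_borel refl])
    ultimately have "AE u in \<nu>. ?F u = 0"
      using integral_nonneg_eq_0_iff_AE[of \<nu> ?F] infdist_nonneg by auto
    then show ?thesis
    proof eventually_elim
      fix u assume "?F u = 0"
      then show "u \<in> K"
        using Kc in_closed_iff_infdist_zero[of K u] sK by (auto simp: min_def split: if_splits)
    qed
  qed
  note AEK = this
  \<comment> \<open>The value off \<open>K\<close> is an arbitrary constant: closedness of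
    \<open>K\<close> makes the map Borel, and \<open>\<nu>\<close> does not see the complement of
    \<open>K\<close>.\<close>
  define \<pi>' where "\<pi>' u = (if u \<in> K then \<pi> u else undefined)" for u
  have \<pi>m: "\<pi>' \<in> borel_measurable borel"
    unfolding \<pi>'_def using borel_measurable_continuous_on_restrict[OF \<pi>cont] Kc
    by (subst measurable_If_restrict_space_iff) auto
  then have \<pi>m': "\<pi>' \<in> borel_measurable \<nu>"
    by (simp add: measurable_cong_sets[OF \<nu>.events_eq_borel refl])
  define \<mu> where "\<mu> = distr \<nu> borel \<pi>'"
  show thesis
  proof (rule that[OF r])
    show "\<mu> \<in> borel_probs" unfolding \<mu>_def borel_probs_def
      using \<nu>.prob_space_distr[OF \<pi>m'] by simp
    show "weak_limit (\<mu>s \<circ> r) \<mu>"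
      unfolding weak_limit_def
    proof (intro allI impI)
      fix f :: "'m \<Rightarrow> real" assume f: "continuous_on UNIV f"
      obtain b where b: "b \<ge> 0" "\<And>q. \<bar>f q\<bar> \<le> b" using compact_UNIV_bounded[OF comp f] by blast
      have "continuous_on K (\<lambda>u. f (\<pi> u))"
        using continuous_on_compose2[OF f \<pi>cont] by simp
      \<comment> \<open>The composition of \<open>f\<close> with \<open>\<pi>\<close> is continuous
        only on \<open>K\<close>, whereas convergence to \<open>\<nu>\<close> is tested on the whole
        line; Tietze extends it with the same bound.\<close>
      then obtain F where F: "continuous_on UNIV F" "\<And>u. u \<in> K \<Longrightarrow> F u = f (\<pi> u)"
        "\<And>u. norm (F u) \<le> b"
        using Tietze[of K "\<lambda>u. f (\<pi> u)" UNIV b] Kc b by auto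
      have "(\<lambda>k. integral\<^sup>L (\<mu>s (r k)) f) \<longlonglongrightarrow> integral\<^sup>L \<nu> F"
        using conv[of F b] F sK \<pi>s by auto
      also have "integral\<^sup>L \<nu> F = integral\<^sup>L \<nu> (\<lambda>u. f (\<pi>' u))"
        using AEK F(2) borel_measurable_continuous_onI[OF F(1)]
          measurable_compose[OF \<pi>m' borel_measurable_continuous_onI[OF f]]
        by (intro integral_cong_AE) (auto simp: \<pi>'_def measurable_cong_sets[OF \<nu>.events_eq_borel refl])
      also have "\<dots> = integral\<^sup>L \<mu> f" unfolding \<mu>_def
        by (rule integral_distr[symmetric, OF \<pi>m' borel_measurable_continuous_onI[OF f]])
      finally show "(\<lambda>k. integral\<^sup>L ((\<mu>s \<circ> r) k) f) \<longlonglongrightarrow> integral\<^sup>L \<mu> f" by simp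
    qed
  qed
qed

section \<open>Extreme points\<close>

text \<open>Finite intersections of balls from a countable family form a countable pi-system
  generating the Borel sets, and each of their indicators is a pointwise limit of continuous
  functions with values in [0, 1]. The bounds on the values later make weighted series of integrals
  converge.\<close>

lemma compact_UNIV_determining_sequence:
  assumes comp: "compact (UNIV :: 'm::metric_space set)"
  obtains f :: "nat \<Rightarrow> 'm::metric_space \<Rightarrow> real"
  where "\<And>i. continuous_on UNIV (f i)" "\<And>i q. 0 \<le> f i q" "\<And>i q. f i q \<le> 1"
    "\<And>\<mu> \<nu>. \<mu> \<in> borel_probs \<Longrightarrow> \<nu> \<in> borel_probs \<Longrightarrow>
      (\<And>i. integral\<^sup>L \<mu> (f i) = integral\<^sup>L \<nu> (f i)) \<Longrightarrow> \<mu> = \<nu>"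
proof -
  obtain c :: "nat \<Rightarrow> 'm" where c: "\<And>e. e > 0 \<Longrightarrow> \<exists>n. \<forall>q. \<exists>i<n. dist (c i) q < e"
    using compact_UNIV_dense_sequence[OF comp] by blast
  \<comment> \<open>A ramp that increases with \<open>n\<close> to the indicator of the open ball
    \<open>U p\<close>.\<close>
  define bump where
    "bump n p q = min 1 (real n * max 0 (1 / real (Suc (snd p)) - dist (c (fst p)) q))"
    for n and p :: "nat \<times> nat" and q
  define F where "F n l q = (\<Prod>p\<in>set l. bump n p q)" for n l q
  define U where "U p = ball (c (fst p)) (1 / real (Suc (snd p)))" for p :: "nat \<times> nat"
  define f where "f i = (case from_nat i of (n, l) \<Rightarrow> F n l)" for i :: nat
  have bump01: "0 \<le> bump n p q" "bump n p q \<le> 1" for n p q unfolding bump_def by auto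
  have Fc: "continuous_on UNIV (F n l)" for n l
    unfolding F_def bump_def by (intro continuous_intros)
  have F0: "0 \<le> F n l q" for n l q unfolding F_def by (intro prod_nonneg ballI bump01)
  have F1: "F n l q \<le> 1" for n l q unfolding F_def by (intro prod_le_1 conjI bump01)
  have bump_lim: "(\<lambda>n. bump n p q) \<longlonglongrightarrow> indicator (U p) q" for p q
  proof (cases "q \<in> U p")
    case True
    define d where "d = 1 / real (Suc (snd p)) - dist (c (fst p)) q"
    have "d > 0" using True by (simp add: U_def d_def)
    have "bump n p q = 1" if "n \<ge> nat \<lceil>1 / d\<rceil>" for n
    proof -
      have "1 / d \<le> real n" using that by linarith
      then have "1 \<le> real n * d" using \<open>d > 0\<close> by (simp add: field_simps)
      then show ?thesis using \<open>d > 0\<close> by (simp add: bump_def d_def[symmetric] del: of_nat_Suc)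
    qed
    then have "(\<lambda>n. bump n p q) \<longlonglongrightarrow> 1"
      by (intro tendsto_eventually eventually_sequentiallyI[of "nat \<lceil>1 / d\<rceil>"])
    then show ?thesis using True by simp
  next
    case False
    then have "bump n p q = 0" for n by (simp add: U_def bump_def)
    then show ?thesis using False by simp
  qed
  have F_lim: "(\<lambda>n. F n l q) \<longlonglongrightarrow> indicator (\<Inter>p\<in>set l. U p) q" for l q
  proof -
    have "(\<lambda>n. F n l q) \<longlonglongrightarrow> (\<Prod>p\<in>set l. indicator (U p) q)"
      unfolding F_def by (intro tendsto_prod bump_lim)
    also have "(\<Prod>p\<in>set l. indicator (U p) q :: real) = indicator (\<Inter>p\<in>set l. U p) q"
      by (auto simp: indicator_def)
    finally show ?thesis .
  qed
  define E where "E = range (\<lambda>l. \<Inter>p\<in>set l. U p)"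
  have UE: "U p \<in> E" for p unfolding E_def by (rule image_eqI[of _ _ "[p]"]) auto
  have openE: "open X" if "X \<in> E" for X using that unfolding E_def U_def by auto
  have sE: "sigma_sets UNIV E = sets borel"
  proof (rule antisym)
    have "E \<subseteq> sets borel" using openE by auto
    then show "sigma_sets UNIV E \<subseteq> sets borel"
      using sets.sigma_sets_subset[of E borel] by simp
    have "X \<in> sigma_sets UNIV E" if "open X" for X
    proof -
      have "\<exists>p. x \<in> U p \<and> U p \<subseteq> X" if x: "x \<in> X" for x
      proof -
        obtain e where e: "e > 0" "ball x e \<subseteq> X" using \<open>open X\<close> x openE open_contains_ball by blast
        obtain k where k: "1 / real (Suc k) < e / 2"
          using nat_approx_posE half_gt_zero[OF e(1)] by blast
        have "1 / real (Suc k) > 0" by simp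
        then obtain i where i: "dist (c i) x < 1 / real (Suc k)" using c by blast
        have "U (i, k) \<subseteq> ball x e"
        proof
          fix y assume "y \<in> U (i, k)"
          then have "dist (c i) y < 1 / real (Suc k)" by (simp add: U_def)
          with i k have "dist x y < e"
            by (smt (verit) dist_commute dist_triangle field_sum_of_halves)
          then show "y \<in> ball x e" by simp
        qed
        moreover have "x \<in> U (i, k)" using i by (simp add: U_def)
        ultimately show ?thesis using e(2) by blast
      qed
      then have "X = (\<Union>p\<in>{p. U p \<subseteq> X}. U p)" by blast
      moreover have "(\<Union>p\<in>{p. U p \<subseteq> X}. U p) \<in> sigma_sets UNIV E"
      proof -
        interpret S: sigma_algebra UNIV "sigma_sets UNIV E" by (rule sigma_algebra_sigma_sets) simp
        show ?thesis using UE by (intro S.countable_UN'' sigma_sets.Basic) auto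
      qed
      ultimately show ?thesis by simp
    qed
    then have "Collect open \<subseteq> sigma_sets UNIV E" by auto
    then show "sets borel \<subseteq> sigma_sets UNIV E"
      unfolding borel_def using sigma_sets_mono[of "Collect open" UNIV E] by simp
  qed
  have determine: "\<mu> = \<nu>" if \<mu>: "\<mu> \<in> borel_probs" and \<nu>: "\<nu> \<in> borel_probs"
    and eq: "\<And>i. integral\<^sup>L \<mu> (f i) = integral\<^sup>L \<nu> (f i)" for \<mu> \<nu>
  proof -
    have lim: "(\<lambda>n. integral\<^sup>L \<mu> (F n l)) \<longlonglongrightarrow> measure \<mu> (\<Inter>p\<in>set l. U p)"
      if "\<mu> \<in> borel_probs" for l and \<mu> :: "'m measure"
    proof -
      interpret prob_space \<mu> by (rule borel_probsD(1)[OF that])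
      have X: "(\<Inter>p\<in>set l. U p) \<in> sets \<mu>"
        using openE[of "\<Inter>p\<in>set l. U p"] borel_probsD(2)[OF that] by (auto simp: E_def)
      have "(\<lambda>n. integral\<^sup>L \<mu> (F n l)) \<longlonglongrightarrow> integral\<^sup>L \<mu> (indicator (\<Inter>p\<in>set l. U p))"
        using X F0 F1 F_lim measurable_borel_probs[OF that Fc]
        by (intro integral_dominated_convergence[where w = "\<lambda>_. 1"]) auto
      then show ?thesis using X by simp
    qed
    have F_eq: "integral\<^sup>L \<mu> (F n l) = integral\<^sup>L \<nu> (F n l)" for n l
      using eq[of "to_nat (n, l)"] by (simp add: f_def)
    show ?thesis
    proof (rule measure_eqI_generator_eq[of E UNIV _ _ "\<lambda>_. UNIV"])
      show "Int_stable E"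
        unfolding Int_stable_def
      proof (intro ballI)
        fix X Y assume "X \<in> E" "Y \<in> E"
        then obtain l l' where "X = (\<Inter>p\<in>set l. U p)" "Y = (\<Inter>p\<in>set l'. U p)"
          unfolding E_def by blast
        then show "X \<inter> Y \<in> E" unfolding E_def by (intro image_eqI[of _ _ "l @ l'"]) auto
      qed
      fix X assume "X \<in> E"
      then obtain l where X: "X = (\<Inter>p\<in>set l. U p)" unfolding E_def by blast
      have "measure \<mu> X = measure \<nu> X"
        using LIMSEQ_unique[OF lim[OF \<mu>, of l]] lim[OF \<nu>, of l] unfolding X F_eq by blast
      then show "emeasure \<mu> X = emeasure \<nu> X"
        using finite_measure.emeasure_eq_measure[OF prob_space.finite_measure[OF borel_probsD(1)[OF \<mu>]]]
          finite_measure.emeasure_eq_measure[OF prob_space.finite_measure[OF borel_probsD(1)[OF \<nu>]]]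
        by simp
    next
      show "range (\<lambda>_. UNIV) \<subseteq> E" unfolding E_def by (auto intro: image_eqI[of _ _ "[]"])
      show "emeasure \<mu> UNIV \<noteq> \<infinity>"
        using finite_measure.emeasure_finite[OF prob_space.finite_measure[OF borel_probsD(1)[OF \<mu>]]]
        by simp
    qed (use sE borel_probsD(2)[OF \<mu>] borel_probsD(2)[OF \<nu>] in auto)
  qed
  show thesis
    by (rule that[of f]) (use Fc F0 F1 determine in \<open>auto simp: f_def split: prod.split\<close>)
qed

text \<open>Continuous functions determine a Borel probability measure on a compact space, so for
  such measures this is the usual convex combination, in a form that needs no sum of
  measures.\<close>

definition mixture ::
  "real \<Rightarrow> 'm::topological_space measure \<Rightarrow> 'm measure \<Rightarrow> 'm measure \<Rightarrow> bool" where
  "mixture t \<mu>1 \<mu>2 \<mu> \<longleftrightarrow> (\<forall>f :: 'm \<Rightarrow> real. continuous_on UNIV f \<longrightarrow>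
     integral\<^sup>L \<mu> f = t * integral\<^sup>L \<mu>1 f + (1 - t) * integral\<^sup>L \<mu>2 f)"

text \<open>
  An extreme point is found by maximising the weakly continuous, strictly convex functional
  \<open>\<mu> \<mapsto> \<Sum>i. (\<integral> f i d\<mu>)\<^sup>2 / 2 ^ i\<close> for a determining sequence \<open>f\<close>.
\<close>

lemma extreme_borel_prob_exists:
  fixes I :: "'m::metric_space measure set"
  assumes comp: "compact (UNIV :: 'm set)" and "I \<noteq> {}" and I: "I \<subseteq> borel_probs"
    and closed: "\<And>\<mu>s \<mu>. (\<And>k. \<mu>s k \<in> I) \<Longrightarrow> \<mu> \<in> borel_probs \<Longrightarrow> weak_limit \<mu>s \<mu> \<Longrightarrow> \<mu> \<in> I"
  shows "\<exists>\<mu>\<in>I. \<forall>\<mu>1\<in>I. \<forall>\<mu>2\<in>I. \<forall>t. 0 < t \<longrightarrow> t < 1 \<longrightarrow> mixture t \<mu>1 \<mu>2 \<mu> \<longrightarrow> \<mu>1 = \<mu>2"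
proof -
  obtain f :: "nat \<Rightarrow> 'm \<Rightarrow> real" where fc: "\<And>i. continuous_on UNIV (f i)"
    and f01: "\<And>i q. 0 \<le> f i q" "\<And>i q. f i q \<le> 1"
    and det: "\<And>\<mu> \<nu>. \<mu> \<in> borel_probs \<Longrightarrow> \<nu> \<in> borel_probs \<Longrightarrow>
      (\<And>i. integral\<^sup>L \<mu> (f i) = integral\<^sup>L \<nu> (f i)) \<Longrightarrow> \<mu> = \<nu>"
    using compact_UNIV_determining_sequence[OF comp] by blast
  define m where "m \<mu> i = integral\<^sup>L \<mu> (f i)" for \<mu> i
  define \<Phi> where "\<Phi> \<mu> = (\<Sum>i. (1/2) ^ i * (m \<mu> i)\<^sup>2)" for \<mu>
  have m01: "0 \<le> m \<mu> i" "m \<mu> i \<le> 1" if "\<mu> \<in> I" for \<mu> i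
  proof -
    have "\<mu> \<in> borel_probs" using that I by blast
    then interpret prob_space \<mu> by (rule borel_probsD)
    show "0 \<le> m \<mu> i" unfolding m_def using f01 by simp
    have "integral\<^sup>L \<mu> (f i) \<le> integral\<^sup>L \<mu> (\<lambda>_. 1)"
      using f01 integrable_borel_probs[OF comp \<open>\<mu> \<in> borel_probs\<close> fc] by (intro integral_mono) auto
    then show "m \<mu> i \<le> 1" unfolding m_def by (simp add: prob_space)
  qed
  have geo: "summable (\<lambda>i. (1/2) ^ i :: real)" by simp
  have summ: "summable (\<lambda>i. (1/2) ^ i * x i)" if "\<And>i. \<bar>x i\<bar> \<le> 1" for x :: "nat \<Rightarrow> real"
    by (rule summable_comparison_test'[OF geo]) (use that in \<open>auto simp: abs_mult intro: mult_left_le\<close>)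
  have sq1: "(m \<mu> i)\<^sup>2 \<le> 1" if "\<mu> \<in> I" for \<mu> i
    using m01[OF that, of i] by (simp add: power_le_one)
  have \<Phi>2: "\<Phi> \<mu> \<le> 2" if "\<mu> \<in> I" for \<mu>
  proof -
    have "\<Phi> \<mu> \<le> (\<Sum>i. (1/2) ^ i)" unfolding \<Phi>_def
      using sq1[OF that] by (intro suminf_le geo summ) (auto intro: mult_left_le)
    then show ?thesis by (simp add: suminf_geometric)
  qed
  define S where "S = Sup (\<Phi> ` I)"
  have bdd: "bdd_above (\<Phi> ` I)" using \<Phi>2 by (intro bdd_aboveI[of _ 2]) auto
  have "\<exists>\<mu>\<in>I. S - 1 / real (Suc k) < \<Phi> \<mu>" for k
    using less_cSup_iff[of "\<Phi> ` I" "S - 1 / real (Suc k)"] bdd \<open>I \<noteq> {}\<close> unfolding S_def by force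
  then obtain \<mu>s where \<mu>s: "\<And>k. \<mu>s k \<in> I" "\<And>k. S - 1 / real (Suc k) < \<Phi> (\<mu>s k)" by metis
  obtain r \<mu> where r: "strict_mono r" and \<mu>: "\<mu> \<in> borel_probs" "weak_limit (\<mu>s \<circ> r) \<mu>"
    using borel_probs_weakly_compact[OF comp, of \<mu>s] \<mu>s(1) I by blast
  have \<mu>I: "\<mu> \<in> I" using closed[of "\<mu>s \<circ> r" \<mu>] \<mu>s(1) \<mu> by simp
  have mlim: "(\<lambda>k. m (\<mu>s (r k)) i) \<longlonglongrightarrow> m \<mu> i" for i
    using \<mu>(2) fc unfolding weak_limit_def m_def by simp
  have lim1: "(\<lambda>k. \<Phi> (\<mu>s (r k))) \<longlonglongrightarrow> \<Phi> \<mu>"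
    unfolding \<Phi>_def
  proof (rule conjunct2[OF conjunct2[OF tannerys_theorem]])
    show "((\<lambda>k. (1/2) ^ i * (m (\<mu>s (r k)) i)\<^sup>2) \<longlongrightarrow> (1/2) ^ i * (m \<mu> i)\<^sup>2) sequentially" for i
      by (intro tendsto_intros mlim)
    show "\<forall>\<^sub>F (i, k) in at_top \<times>\<^sub>F sequentially. norm ((1/2) ^ i * (m (\<mu>s (r k)) i)\<^sup>2) \<le> (1/2) ^ i"
      using sq1[OF \<mu>s(1)] by (intro always_eventually) (auto simp: abs_mult intro: mult_left_le)
  qed (use geo in auto)
  have lim2: "(\<lambda>k. S - 1 / real (Suc (r k))) \<longlonglongrightarrow> S - 0"
    using LIMSEQ_subseq_LIMSEQ[OF LIMSEQ_inverse_real_of_nat r]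
    by (intro tendsto_intros) (simp add: o_def inverse_eq_divide)
  have S\<mu>: "S \<le> \<Phi> \<mu>"
    using LIMSEQ_le[OF lim2 lim1] \<mu>s(2) less_imp_le by auto
  show ?thesis
  proof (intro bexI[OF _ \<mu>I] ballI allI impI)
    fix \<mu>1 \<mu>2 and t :: real
    assume \<mu>12: "\<mu>1 \<in> I" "\<mu>2 \<in> I" and t: "0 < t" "t < 1" and mix: "mixture t \<mu>1 \<mu>2 \<mu>"
    have comb: "m \<mu> i = t * m \<mu>1 i + (1 - t) * m \<mu>2 i" for i
      using mix fc unfolding mixture_def m_def by blast
    have le: "\<Phi> \<mu>1 \<le> S" "\<Phi> \<mu>2 \<le> S" unfolding S_def using \<mu>12 bdd by (auto intro: cSup_upper)
    \<comment> \<open>\<open>t * (1 - t) * D\<close> is the exact convexity defect of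
      \<open>\<Phi>\<close> between \<open>\<mu>1\<close> and \<open>\<mu>2\<close>. Maximality of
      \<open>\<Phi> \<mu>\<close> leaves no room for it, so all integrals of the \<open>f i\<close>
      agree.\<close>
    define D where "D = (\<Sum>i. (1/2) ^ i * (m \<mu>1 i - m \<mu>2 i)\<^sup>2)"
    have ab: "\<bar>m \<mu>1 i - m \<mu>2 i\<bar> \<le> 1" for i
      using m01[OF \<mu>12(1), of i] m01[OF \<mu>12(2), of i] by linarith
    have sD: "summable (\<lambda>i. (1/2) ^ i * (m \<mu>1 i - m \<mu>2 i)\<^sup>2)"
      using ab by (intro summ) (simp add: abs_square_le_1)
    have s1: "summable (\<lambda>i. (1/2) ^ i * (m \<mu>1 i)\<^sup>2)" "summable (\<lambda>i. (1/2) ^ i * (m \<mu>2 i)\<^sup>2)"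
      using sq1 \<mu>12 by (intro summ; simp)+
    have "(1/2) ^ i * (m \<mu> i)\<^sup>2 = t * ((1/2) ^ i * (m \<mu>1 i)\<^sup>2) + (1 - t) * ((1/2) ^ i * (m \<mu>2 i)\<^sup>2)
        - t * (1 - t) * ((1/2) ^ i * (m \<mu>1 i - m \<mu>2 i)\<^sup>2)" for i
      unfolding comb by (simp add: power2_eq_square algebra_simps)
    then have "\<Phi> \<mu> = t * \<Phi> \<mu>1 + (1 - t) * \<Phi> \<mu>2 - t * (1 - t) * D"
      unfolding \<Phi>_def D_def using s1 sD
      by (simp add: suminf_diff suminf_add suminf_mult summable_mult summable_add flip: suminf_mult)
    moreover have "t * \<Phi> \<mu>1 + (1 - t) * \<Phi> \<mu>2 \<le> t * S + (1 - t) * S"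
      using le t by (intro add_mono mult_left_mono) auto
    ultimately have "t * (1 - t) * D \<le> 0" using S\<mu> by (simp add: algebra_simps)
    then have "D \<le> 0" using t by (simp add: mult_le_0_iff)
    moreover have "D \<ge> 0" unfolding D_def by (intro suminf_nonneg sD) auto
    ultimately have "\<forall>i. (1/2) ^ i * (m \<mu>1 i - m \<mu>2 i)\<^sup>2 = 0"
      using suminf_eq_zero_iff[OF sD] unfolding D_def by simp
    then show "\<mu>1 = \<mu>2" using \<mu>12 I by (intro det) (auto simp: m_def)
  qed
qed

section \<open>Invariant measures\<close>

lemma integral_uniform_measure:
  fixes f :: "'a \<Rightarrow> real"
  assumes f: "f \<in> borel_measurable M" and B: "B \<in> sets M"
    and fin: "emeasure M B \<noteq> 0" "emeasure M B \<noteq> \<infinity>"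
  shows "integral\<^sup>L (uniform_measure M B) f = (\<integral>q. indicator B q * f q \<partial>M) / measure M B"
proof -
  have e: "emeasure M B = ennreal (measure M B)"
    using fin(2) by (intro emeasure_eq_ennreal_measure) (simp add: top.not_eq_extremum)
  have "measure M B \<noteq> 0" using e fin(1) by force
  then have pos: "measure M B > 0" by (simp add: less_le)
  have "uniform_measure M B = density M (\<lambda>q. ennreal (indicator B q / measure M B))"
    unfolding uniform_measure_def e using pos
    by (intro arg_cong[where f = "density M"] ext)
       (auto simp: divide_ennreal indicator_def simp flip: ennreal_1)
  also have "integral\<^sup>L \<dots> f = (\<integral>q. indicator B q / measure M B * f q \<partial>M)"
    using B f by (subst integral_real_density) auto
  also have "\<dots> = (\<integral>q. indicator B q * f q \<partial>M) / measure M B"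
    by (simp flip: integral_divide_zero)
  finally show ?thesis .
qed

locale compact_semiflow =
  fixes \<phi> :: "real \<Rightarrow> 'm::metric_space \<Rightarrow> 'm"
  assumes compact_space: "compact (UNIV :: 'm set)" and semiflow: "semiflow \<phi>"
begin

lemma flow_continuous: "t \<ge> 0 \<Longrightarrow> continuous_on UNIV (\<phi> t)"
  and flow_0: "\<phi> 0 q = q"
  and flow_add: "t \<ge> 0 \<Longrightarrow> s \<ge> 0 \<Longrightarrow> \<phi> (t + s) q = \<phi> t (\<phi> s q)"
  and flow_joint: "continuous_on (UNIV \<times> {0..}) (\<lambda>(q, t). \<phi> t q)"
  using semiflow unfolding semiflow_def by auto

lemma flow_continuous_time: "continuous_on {0..} (\<lambda>t. \<phi> t q)"
proof -
  have "continuous_on {0..} (\<lambda>t. (\<lambda>(q, t). \<phi> t q) (q, t))"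
    by (rule continuous_on_compose2[OF flow_joint]) (auto intro!: continuous_intros)
  then show ?thesis by simp
qed

lemma invariant_distr:
  assumes "invariant_prob_measure \<phi> \<mu>" "t \<ge> 0"
  shows "distr \<mu> borel (\<phi> t) = \<mu>"
proof -
  have \<mu>: "\<mu> \<in> borel_probs" using assms(1) by (simp add: invariant_prob_measure_def borel_probs_def)
  show ?thesis
    using assms emeasure_distr[OF measurable_borel_probs[OF \<mu> flow_continuous[OF assms(2)]]]
      borel_probsD[OF \<mu>]
    by (intro measure_eqI) (auto simp: invariant_prob_measure_def)
qed

text \<open>Integrals of continuous functions pass to weak limits, measures of sets in general do
  not. The direction back to sets holds because such integrals identify the image measure under
  \<open>\<phi> t\<close> with \<open>\<mu>\<close>.\<close>

lemma invariant_iff_integral: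
  "invariant_prob_measure \<phi> \<mu> \<longleftrightarrow> \<mu> \<in> borel_probs \<and>
    (\<forall>t\<ge>0. \<forall>f :: 'm \<Rightarrow> real. continuous_on UNIV f \<longrightarrow>
      integral\<^sup>L \<mu> (\<lambda>q. f (\<phi> t q)) = integral\<^sup>L \<mu> f)" (is "?L \<longleftrightarrow> ?R")
proof -
  have distr: "integral\<^sup>L (distr \<mu> borel (\<phi> t)) f = integral\<^sup>L \<mu> (\<lambda>q. f (\<phi> t q))"
    if "\<mu> \<in> borel_probs" "t \<ge> 0" "continuous_on UNIV f" for t and f :: "'m \<Rightarrow> real"
    using measurable_borel_probs[OF that(1) flow_continuous[OF that(2)]]
      borel_measurable_continuous_onI[OF that(3)] by (rule integral_distr)
  have emeasure: "emeasure (distr \<mu> borel (\<phi> t)) B = emeasure \<mu> (\<phi> t -` B)"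
    if "\<mu> \<in> borel_probs" "t \<ge> 0" "B \<in> sets borel" for t B
    using emeasure_distr[OF measurable_borel_probs[OF that(1) flow_continuous[OF that(2)]] that(3)]
      borel_probsD(3)[OF that(1)] by simp
  show ?thesis
  proof
    assume L: ?L
    then have \<mu>: "\<mu> \<in> borel_probs" by (simp add: invariant_prob_measure_def borel_probs_def)
    with \<mu> L show ?R using distr[OF \<mu>] invariant_distr by force
  next
    assume R: ?R
    then have \<mu>: "\<mu> \<in> borel_probs" by simp
    obtain f :: "nat \<Rightarrow> 'm \<Rightarrow> real" where fc: "\<And>i. continuous_on UNIV (f i)"
      and "\<And>i q. 0 \<le> f i q" "\<And>i q. f i q \<le> 1"
      and det: "\<And>\<mu> \<nu>. \<mu> \<in> borel_probs \<Longrightarrow> \<nu> \<in> borel_probs \<Longrightarrow>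
        (\<And>i. integral\<^sup>L \<mu> (f i) = integral\<^sup>L \<nu> (f i)) \<Longrightarrow> \<mu> = \<nu>"
      using compact_UNIV_determining_sequence[OF compact_space] by blast
    have "distr \<mu> borel (\<phi> t) = \<mu>" if "t \<ge> 0" for t
    proof (rule det)
      show "distr \<mu> borel (\<phi> t) \<in> borel_probs"
        using prob_space.prob_space_distr[OF borel_probsD(1)[OF \<mu>]
            measurable_borel_probs[OF \<mu> flow_continuous[OF that]]]
        by (simp add: borel_probs_def)
      fix i
      show "integral\<^sup>L (distr \<mu> borel (\<phi> t)) (f i) = integral\<^sup>L \<mu> (f i)"
        unfolding distr[OF \<mu> that fc] using R that fc by blast
    qed (rule \<mu>)
    then have "emeasure \<mu> (\<phi> t -` B) = emeasure \<mu> B" if "t \<ge> 0" "B \<in> sets borel" for t B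
      using emeasure[OF \<mu> that] that(1) by metis
    then show ?L using borel_probsD[OF \<mu>] by (simp add: invariant_prob_measure_def)
  qed
qed

lemma invariant_borel_probs: "invariant_prob_measure \<phi> \<mu> \<Longrightarrow> \<mu> \<in> borel_probs"
  by (simp add: invariant_iff_integral)

lemma invariant_integral:
  fixes f :: "'m \<Rightarrow> real"
  shows "invariant_prob_measure \<phi> \<mu> \<Longrightarrow> t \<ge> 0 \<Longrightarrow> continuous_on UNIV f \<Longrightarrow>
    integral\<^sup>L \<mu> (\<lambda>q. f (\<phi> t q)) = integral\<^sup>L \<mu> f"
  by (simp add: invariant_iff_integral)

lemma invariant_weak_limit:
  assumes "\<And>k. invariant_prob_measure \<phi> (\<mu>s k)" "\<mu> \<in> borel_probs" "weak_limit \<mu>s \<mu>"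
  shows "invariant_prob_measure \<phi> \<mu>"
  unfolding invariant_iff_integral
proof (intro conjI allI impI assms)
  fix t :: real and f :: "'m \<Rightarrow> real" assume t: "t \<ge> 0" and f: "continuous_on UNIV f"
  have "continuous_on UNIV (\<lambda>q. f (\<phi> t q))"
    using continuous_on_compose2[OF f flow_continuous[OF t]] by simp
  then have "(\<lambda>k. integral\<^sup>L (\<mu>s k) (\<lambda>q. f (\<phi> t q))) \<longlonglongrightarrow> integral\<^sup>L \<mu> (\<lambda>q. f (\<phi> t q))"
    using assms(3) by (simp add: weak_limit_def)
  moreover have "(\<lambda>k. integral\<^sup>L (\<mu>s k) f) \<longlonglongrightarrow> integral\<^sup>L \<mu> f"
    using assms(3) f by (simp add: weak_limit_def)
  ultimately show "integral\<^sup>L \<mu> (\<lambda>q. f (\<phi> t q)) = integral\<^sup>L \<mu> f"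
    using invariant_integral[OF assms(1) t f] by (simp add: LIMSEQ_unique)
qed

text \<open>For an invariant \<open>B\<close>, intersecting with \<open>B\<close> commutes with
  taking preimages under \<open>\<phi> t\<close>.\<close>

lemma invariant_uniform_measure:
  assumes \<mu>: "invariant_prob_measure \<phi> \<mu>" and B: "B \<in> sets borel" "\<And>t. t \<ge> 0 \<Longrightarrow> \<phi> t -` B = B"
    and "emeasure \<mu> B \<noteq> 0"
  shows "invariant_prob_measure \<phi> (uniform_measure \<mu> B)"
proof -
  note p = borel_probsD[OF invariant_borel_probs[OF \<mu>]]
  interpret prob_space \<mu> by (rule p)
  have "emeasure (uniform_measure \<mu> B) (\<phi> t -` C) = emeasure (uniform_measure \<mu> B) C"
    if "t \<ge> 0" "C \<in> sets borel" for t C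
  proof -
    have C: "\<phi> t -` C \<in> sets borel"
      using measurable_sets_borel[OF borel_measurable_continuous_onI[OF flow_continuous[OF that(1)]] that(2)] .
    have "B \<inter> \<phi> t -` C = \<phi> t -` (B \<inter> C)" using B(2)[OF that(1)] by auto
    moreover have "emeasure \<mu> (\<phi> t -` (B \<inter> C)) = emeasure \<mu> (B \<inter> C)"
      using \<mu> that B(1) unfolding invariant_prob_measure_def by blast
    ultimately show ?thesis using that B(1) C p by simp
  qed
  then show ?thesis using prob_space_uniform_measure[OF assms(4)] p
    by (simp add: invariant_prob_measure_def)
qed

text \<open>If an invariant set \<open>B\<close> had measure strictly between 0 and 1,
  \<open>\<mu>\<close> would be a mixture of its conditional measures on \<open>B\<close> and on the
  complement. Both are invariant, so \<open>face\<close> keeps them in \<open>I\<close>; extremality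
  within \<open>I\<close> makes them equal, although one gives \<open>B\<close> mass 1 and the other
  mass 0.\<close>

lemma ergodic_in_face_exists:
  assumes "I \<noteq> {}" and I: "\<And>\<mu>. \<mu> \<in> I \<Longrightarrow> invariant_prob_measure \<phi> \<mu>"
    and closed: "\<And>\<mu>s \<mu>. (\<And>k. \<mu>s k \<in> I) \<Longrightarrow> \<mu> \<in> borel_probs \<Longrightarrow> weak_limit \<mu>s \<mu> \<Longrightarrow> \<mu> \<in> I"
    and face: "\<And>\<mu> \<mu>1 \<mu>2 t. \<mu> \<in> I \<Longrightarrow> invariant_prob_measure \<phi> \<mu>1 \<Longrightarrow>
      invariant_prob_measure \<phi> \<mu>2 \<Longrightarrow> 0 < t \<Longrightarrow> t < 1 \<Longrightarrow> mixture t \<mu>1 \<mu>2 \<mu> \<Longrightarrow> \<mu>1 \<in> I"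
  obtains \<mu> where "\<mu> \<in> I" "\<mu> \<in> ergodic_measures \<phi>"
proof -
  have "I \<subseteq> borel_probs" using I invariant_borel_probs by blast
  have "\<exists>\<mu>\<in>I. \<forall>\<mu>1\<in>I. \<forall>\<mu>2\<in>I. \<forall>t. 0 < t \<longrightarrow> t < 1 \<longrightarrow> mixture t \<mu>1 \<mu>2 \<mu> \<longrightarrow> \<mu>1 = \<mu>2"
    by (rule extreme_borel_prob_exists[OF compact_space \<open>I \<noteq> {}\<close> \<open>I \<subseteq> borel_probs\<close>]) (fact closed)
  then obtain \<mu> where \<mu>I: "\<mu> \<in> I" and extreme: "\<And>\<mu>1 \<mu>2 t. \<mu>1 \<in> I \<Longrightarrow> \<mu>2 \<in> I \<Longrightarrow>
      0 < t \<Longrightarrow> t < 1 \<Longrightarrow> mixture t \<mu>1 \<mu>2 \<mu> \<Longrightarrow> \<mu>1 = \<mu>2"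
    by blast
  note inv = I[OF \<mu>I]
  note p = borel_probsD[OF invariant_borel_probs[OF inv]]
  interpret prob_space \<mu> by (rule p)
  have "emeasure \<mu> B = 0 \<or> emeasure \<mu> B = 1"
    if B: "B \<in> sets borel" "\<And>t. t \<ge> 0 \<Longrightarrow> \<phi> t -` B = B" for B
  proof (rule ccontr)
    assume neq: "\<not> ?thesis"
    define t where "t = measure \<mu> B"
    have B': "- B \<in> sets borel" "\<And>t. t \<ge> 0 \<Longrightarrow> \<phi> t -` (- B) = - B"
      using B by (auto simp: vimage_Compl)
    have t': "measure \<mu> (- B) = 1 - t"
      using prob_compl[of B] B p by (simp add: t_def Compl_eq_Diff_UNIV)
    have t: "0 < t" "t < 1"
      using neq prob_le_1[of B] measure_nonneg[of \<mu> B] unfolding t_def emeasure_eq_measure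
      by (auto simp: less_le)
    have nz: "emeasure \<mu> B \<noteq> 0" "emeasure \<mu> (- B) \<noteq> 0"
      using t t' unfolding emeasure_eq_measure t_def by auto
    let ?\<mu>1 = "uniform_measure \<mu> B" and ?\<mu>2 = "uniform_measure \<mu> (- B)"
    have i1: "invariant_prob_measure \<phi> ?\<mu>1" by (rule invariant_uniform_measure[OF inv B nz(1)])
    have i2: "invariant_prob_measure \<phi> ?\<mu>2" by (rule invariant_uniform_measure[OF inv B' nz(2)])
    have comb: "integral\<^sup>L \<mu> f = t * integral\<^sup>L ?\<mu>1 f + (1 - t) * integral\<^sup>L ?\<mu>2 f"
      if f: "continuous_on UNIV f" for f :: "'m \<Rightarrow> real"
    proof -
      note \<mu>p = invariant_borel_probs[OF inv]
      note int = integrable_borel_probs[OF compact_space \<mu>p f]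
      have int': "integrable \<mu> (\<lambda>q. indicator C q * f q)" if "C \<in> sets borel" for C
        using integrable_mult_indicator[OF _ int, of C] that p by simp
      have "integral\<^sup>L \<mu> f = (\<integral>q. indicator B q * f q + indicator (- B) q * f q \<partial>\<mu>)"
        by (intro Bochner_Integration.integral_cong) (auto simp: indicator_def)
      also have "\<dots> = (\<integral>q. indicator B q * f q \<partial>\<mu>) + (\<integral>q. indicator (- B) q * f q \<partial>\<mu>)"
        by (intro Bochner_Integration.integral_add int' B B')
      finally have "integral\<^sup>L \<mu> f =
        (\<integral>q. indicator B q * f q \<partial>\<mu>) + (\<integral>q. indicator (- B) q * f q \<partial>\<mu>)" .
      moreover have "integral\<^sup>L (uniform_measure \<mu> C) f = (\<integral>q. indicator C q * f q \<partial>\<mu>) / measure \<mu> C"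
        if "C \<in> sets borel" "emeasure \<mu> C \<noteq> 0" for C
        using integral_uniform_measure[OF measurable_borel_probs[OF \<mu>p f], of C] that p by simp
      ultimately show ?thesis using B(1) B'(1) nz t t' by (simp add: t_def)
    qed
    have mix: "mixture t ?\<mu>1 ?\<mu>2 \<mu>" using comb by (simp add: mixture_def)
    \<comment> \<open>\<open>face\<close> speaks about the first component only; exchanging the
      roles covers the second.\<close>
    then have mix': "mixture (1 - t) ?\<mu>2 ?\<mu>1 \<mu>" by (simp add: mixture_def)
    have "?\<mu>1 \<in> I" by (rule face[OF \<mu>I i1 i2 t mix])
    moreover have "?\<mu>2 \<in> I"
      by (rule face[OF \<mu>I i2 i1 _ _ mix']) (use t in auto)
    ultimately have "?\<mu>1 = ?\<mu>2" by (rule extreme[OF _ _ t mix])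
    moreover have "emeasure ?\<mu>1 B \<noteq> emeasure ?\<mu>2 B"
    proof -
      have "emeasure ?\<mu>1 B = 1" using emeasure_uniform_measure_1[OF nz(1)] by simp
      moreover have "emeasure ?\<mu>2 B = 0" using B B' p by simp
      ultimately show ?thesis by simp
    qed
    ultimately show False by simp
  qed
  then have "\<mu> \<in> ergodic_measures \<phi>" using inv by (simp add: ergodic_measures_def)
  with \<mu>I show thesis by (rule that)
qed

end

section \<open>Subadditive families\<close>

lemma has_integral_shift:
  fixes F :: "real \<Rightarrow> real"
  assumes "F integrable_on {a + s..b + s}"
  shows "((\<lambda>u. F (u + s)) has_integral integral {a + s..b + s} F) {a..b}"
  using has_integral_affinity'[of F "integral {a + s..b + s} F" "a + s" "b + s" 1 s] assms
  by (simp add: integrable_integral)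

section \<open>Time averages along orbits\<close>

context compact_semiflow
begin

text \<open>The flow is unconstrained at negative times; clamping by \<open>max 0 u\<close> makes
  the orbit map continuous on the whole line and changes nothing on \<open>{0..T}\<close>.\<close>

definition time_average :: "real \<Rightarrow> 'm \<Rightarrow> 'm measure" where
  "time_average T q = distr (uniform_measure lborel {0..T}) borel (\<lambda>u. \<phi> (max 0 u) q)"

lemma time_average_measurable:
  "(\<lambda>u. \<phi> (max 0 u) q) \<in> borel_measurable (uniform_measure lborel {0..T})"
proof -
  have "continuous_on UNIV (\<lambda>u. \<phi> (max 0 u) q)"
    by (rule continuous_on_compose2[OF flow_continuous_time]) (auto intro!: continuous_intros)
  then show ?thesis
    by (simp add: borel_measurable_continuous_onI
        measurable_cong_sets[of "uniform_measure lborel {0..T}" borel borel borel])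
qed

lemma time_average_borel_probs:
  assumes "T > 0" shows "time_average T q \<in> borel_probs"
proof -
  have "prob_space (uniform_measure lborel {0..T})"
    using assms by (intro prob_space_uniform_measure) auto
  then show ?thesis
    unfolding time_average_def borel_probs_def
    using prob_space.prob_space_distr[OF _ time_average_measurable] by simp
qed

lemma orbit_continuous:
  fixes f :: "'m \<Rightarrow> real"
  assumes "continuous_on UNIV f"
  shows "continuous_on {0..} (\<lambda>u. f (\<phi> u q))"
  by (rule continuous_on_compose2[OF assms flow_continuous_time]) auto

lemma integral_time_average:
  fixes f :: "'m \<Rightarrow> real"
  assumes T: "T > 0" and f: "continuous_on UNIV f"
  shows "integral\<^sup>L (time_average T q) f = integral {0..T} (\<lambda>u. f (\<phi> u q)) / T"
proof -
  have "continuous_on UNIV (\<lambda>u. f (\<phi> (max 0 u) q))"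
    by (rule continuous_on_compose2[OF orbit_continuous[OF f]]) (auto intro!: continuous_intros)
  then have meas: "(\<lambda>u. f (\<phi> (max 0 u) q)) \<in> borel_measurable lborel"
    by (simp add: borel_measurable_continuous_onI)
  have "integral\<^sup>L (time_average T q) f = integral\<^sup>L (uniform_measure lborel {0..T}) (\<lambda>u. f (\<phi> (max 0 u) q))"
    unfolding time_average_def
    by (rule integral_distr[OF time_average_measurable borel_measurable_continuous_onI[OF f]])
  also have "\<dots> = (LINT u|lborel. indicator {0..T} u * f (\<phi> (max 0 u) q)) / measure lborel {0..T}"
    using T by (intro integral_uniform_measure meas) auto
  also have "(LINT u|lborel. indicator {0..T} u * f (\<phi> (max 0 u) q)) =
      (LINT u:{0..T}|lborel. f (\<phi> u q))"
    unfolding set_lebesgue_integral_def by (intro Bochner_Integration.integral_cong) (auto simp: indicator_def)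
  also have "\<dots> = integral {0..T} (\<lambda>u. f (\<phi> u q))"
    using continuous_on_subset[OF orbit_continuous[OF f]]
    by (intro set_borel_integral_eq_integral(2) borel_integrable_atLeastAtMost') auto
  finally show ?thesis using T by simp
qed

text \<open>Krylov-Bogolyubov argument: composing with \<open>\<phi> s\<close> shifts the window of
  integration, which changes the integral only through \<open>{0..s}\<close> and
  \<open>{T..T + s}\<close>. Each piece contributes at most \<open>s * b\<close>, negligible against
  \<open>T\<close>. The base points vary with \<open>k\<close> because they will be maximisers for
  growing times.\<close>

lemma invariant_weak_limit_time_average:
  assumes T: "\<And>k. T k > 0" "filterlim T at_top sequentially"
    and \<mu>: "\<mu> \<in> borel_probs" and lim: "weak_limit (\<lambda>k. time_average (T k) (qs k)) \<mu>"
  shows "invariant_prob_measure \<phi> \<mu>"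
  unfolding invariant_iff_integral
proof (intro conjI allI impI \<mu>)
  fix s :: real and f :: "'m \<Rightarrow> real" assume s: "s \<ge> 0" and f: "continuous_on UNIV f"
  obtain b where b: "\<And>q. \<bar>f q\<bar> \<le> b" using compact_UNIV_bounded[OF compact_space f] by metis
  have fs: "continuous_on UNIV (\<lambda>q. f (\<phi> s q))"
    using continuous_on_compose2[OF f flow_continuous[OF s]] by simp
  have bound: "\<bar>integral\<^sup>L (time_average T q) (\<lambda>q. f (\<phi> s q)) - integral\<^sup>L (time_average T q) f\<bar> \<le> 2 * s * b / T"
    if T: "T > 0" for T q
  proof -
    let ?F = "\<lambda>u. f (\<phi> u q)"
    have int: "?F integrable_on {x..y}" if "x \<ge> 0" for x y
      using continuous_on_subset[OF orbit_continuous[OF f]] that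
      by (intro integrable_continuous_real) auto
    have est: "\<bar>integral {x..y} ?F\<bar> \<le> b * (y - x)" if "0 \<le> x" "x \<le> y" for x y
      using integral_bound[of x y ?F b] continuous_on_subset[OF orbit_continuous[OF f], of "{x..y}" q] b that
      by auto
    have "integral {0..T} (\<lambda>u. f (\<phi> s (\<phi> u q))) = integral {0..T} (\<lambda>u. ?F (u + s))"
      using flow_add[OF s] by (intro Henstock_Kurzweil_Integration.integral_cong) (auto simp: add.commute)
    also have "\<dots> = integral {s..T + s} ?F"
    proof -
      have "((\<lambda>u. ?F (u + s)) has_integral integral {s..T + s} ?F) {0..T}"
        using has_integral_shift[of ?F 0 s T] int[OF s] by simp
      then show ?thesis by (rule integral_unique)
    qed
    finally have shift: "integral {0..T} (\<lambda>u. f (\<phi> s (\<phi> u q))) = integral {s..T + s} ?F" .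
    have "integral {0..s} ?F + integral {s..T + s} ?F = integral {0..T + s} ?F"
      using s T by (intro Henstock_Kurzweil_Integration.integral_combine int) auto
    moreover have "integral {0..T} ?F + integral {T..T + s} ?F = integral {0..T + s} ?F"
      using s T by (intro Henstock_Kurzweil_Integration.integral_combine int) auto
    moreover have "\<bar>integral {0..s} ?F\<bar> \<le> b * s" "\<bar>integral {T..T + s} ?F\<bar> \<le> b * s"
      using est[of 0 s] est[of T "T + s"] s T by auto
    ultimately have "\<bar>integral {s..T + s} ?F - integral {0..T} ?F\<bar> \<le> 2 * s * b"
      by (simp add: algebra_simps)
    then show ?thesis
      unfolding integral_time_average[OF T f] integral_time_average[OF T fs] shift
        diff_divide_distrib[symmetric] abs_divide using T by (simp add: divide_right_mono)
  qed
  let ?\<mu> = "\<lambda>k. time_average (T k) (qs k)"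
  have "(\<lambda>k. integral\<^sup>L (?\<mu> k) (\<lambda>q. f (\<phi> s q)) - integral\<^sup>L (?\<mu> k) f)
      \<longlonglongrightarrow> integral\<^sup>L \<mu> (\<lambda>q. f (\<phi> s q)) - integral\<^sup>L \<mu> f"
    using lim f fs unfolding weak_limit_def by (intro tendsto_diff) auto
  moreover have "(\<lambda>k. integral\<^sup>L (?\<mu> k) (\<lambda>q. f (\<phi> s q)) - integral\<^sup>L (?\<mu> k) f) \<longlonglongrightarrow> 0"
  proof (rule Lim_null_comparison)
    show "(\<lambda>k. 2 * s * b / T k) \<longlonglongrightarrow> 0"
      by (rule real_tendsto_divide_at_top[OF tendsto_const T(2)])
  qed (use bound[OF T(1)] in auto)
  ultimately show "integral\<^sup>L \<mu> (\<lambda>q. f (\<phi> s q)) = integral\<^sup>L \<mu> f"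
    using LIMSEQ_unique by fastforce
qed

end

section \<open>Maximal growth rate of a subadditive family\<close>

locale subadditive_family = compact_semiflow \<phi> for \<phi> :: "real \<Rightarrow> 'm::metric_space \<Rightarrow> 'm" +
  fixes g :: "real \<Rightarrow> 'm \<Rightarrow> real"
  assumes continuous: "continuous_on (UNIV \<times> {0..}) (\<lambda>(q, t). g t q)"
    and subadditive: "\<And>t s q. t \<ge> 0 \<Longrightarrow> s \<ge> 0 \<Longrightarrow> g (t + s) q \<le> g t (\<phi> s q) + g s q"
    and nonneg_somewhere: "\<And>n::nat. n \<ge> 1 \<Longrightarrow> \<exists>q. g (real n) q \<ge> 0"
begin

lemma g_continuous: "t \<ge> 0 \<Longrightarrow> continuous_on UNIV (g t)"
proof -
  assume "t \<ge> 0"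
  then have "continuous_on UNIV (\<lambda>q. (\<lambda>(q, t). g t q) (q, t))"
    by (intro continuous_on_compose2[OF continuous]) (auto intro!: continuous_intros)
  then show ?thesis by simp
qed

lemma g_integrable: "\<mu> \<in> borel_probs \<Longrightarrow> t \<ge> 0 \<Longrightarrow> integrable \<mu> (g t)"
  by (rule integrable_borel_probs[OF compact_space _ g_continuous])

lemma g_bounded:
  obtains L where "L \<ge> 0" "\<And>t q. 0 \<le> t \<Longrightarrow> t \<le> T \<Longrightarrow> \<bar>g t q\<bar> \<le> L"
proof -
  have "compact ((UNIV :: 'm set) \<times> {0..T})" by (intro compact_Times compact_space) auto
  then have "compact ((\<lambda>(q, t). g t q) ` (UNIV \<times> {0..T}))"
    by (rule compact_continuous_image[OF continuous_on_subset[OF continuous], rotated]) auto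
  then have "bounded ((\<lambda>(q, t). g t q) ` (UNIV \<times> {0..T}))" by (rule compact_imp_bounded)
  then obtain L where L: "\<forall>x\<in>(\<lambda>(q, t). g t q) ` (UNIV \<times> {0..T}). norm x \<le> L"
    unfolding bounded_iff by blast
  have "\<bar>g t q\<bar> \<le> max 0 L" if "0 \<le> t" "t \<le> T" for t q
    using bspec[OF L, of "g t q"] that by force
  then show thesis by (intro that[of "max 0 L"]) auto
qed

definition sup_g :: "nat \<Rightarrow> real" where "sup_g n = Sup (range (g (real n)))"

lemma sup_g_attained: obtains q where "g (real n) q = sup_g n" "\<And>q'. g (real n) q' \<le> sup_g n"
proof -
  obtain q where q: "\<And>q'. g (real n) q' \<le> g (real n) q"
    using continuous_attains_sup[OF compact_space UNIV_not_empty g_continuous[of "real n"]] by auto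
  then have "sup_g n = g (real n) q" unfolding sup_g_def by (intro cSup_eq_maximum) auto
  with q show thesis by (intro that[of q]) auto
qed

lemma g_le_sup_g: "g (real n) q \<le> sup_g n"
  using sup_g_attained[of n] by metis

text \<open>By Fekete's lemma this infimum is the limit of \<open>sup_g n / n\<close>. Time 0 is
  excluded: the quotient is 0 there by convention and would force
  \<open>growth \<le> 0\<close>.\<close>

definition growth :: real where "growth = Inf ((\<lambda>n. sup_g n / real n) ` {1..})"

lemma sup_g_nonneg: "n \<ge> 1 \<Longrightarrow> sup_g n \<ge> 0"
  using nonneg_somewhere g_le_sup_g order_trans by blast

lemma growth_bdd: "bdd_below ((\<lambda>n. sup_g n / real n) ` {1..})"
  using sup_g_nonneg by (intro bdd_belowI[of _ 0]) auto

lemma growth_nonneg: "growth \<ge> 0"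
  unfolding growth_def using sup_g_nonneg by (intro cInf_greatest) auto

lemma growth_le: "n \<ge> 1 \<Longrightarrow> real n * growth \<le> sup_g n"
  using cInf_lower[OF _ growth_bdd, of "sup_g n / real n"] unfolding growth_def
  by (auto simp: field_simps)

lemma growth_approx:
  assumes "e > 0" obtains n where "n \<ge> 1" "sup_g n < real n * (growth + e)"
proof -
  have "\<exists>x\<in>(\<lambda>n. sup_g n / real n) ` {1..}. x < growth + e"
    using cInf_lessD[of "(\<lambda>n. sup_g n / real n) ` {1..}" "growth + e"] assms unfolding growth_def by auto
  then obtain n where "n \<ge> 1" "sup_g n / real n < growth + e" by auto
  then show thesis by (intro that[of n]) (auto simp: field_simps)
qed

text \<open>The induction starts at \<open>k = 1\<close> because subadditivity at time 0 gives
  \<open>g 0 q \<ge> 0\<close> and not the inequality that \<open>k = 0\<close> would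
  require.\<close>

lemma sup_g_mult_le: "k \<ge> 1 \<Longrightarrow> sup_g (k * n) \<le> real k * sup_g n"
proof (induction k rule: nat_induct_at_least)
  case (Suc k)
  obtain q where q: "g (real (Suc k * n)) q = sup_g (Suc k * n)" using sup_g_attained by metis
  have "g (real n + real (k * n)) q \<le> g (real n) (\<phi> (real (k * n)) q) + g (real (k * n)) q"
    by (rule subadditive) auto
  also have "\<dots> \<le> sup_g n + sup_g (k * n)" by (intro add_mono g_le_sup_g)
  also have "\<dots> \<le> real (Suc k) * sup_g n" using Suc by (simp add: algebra_simps)
  finally show ?case using q by (simp add: algebra_simps)
qed simp

text \<open>Invariance gives every block of length \<open>n\<close> along the orbit the same
  integral.\<close>

lemma integral_mult_le:
  assumes \<mu>: "invariant_prob_measure \<phi> \<mu>"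
  shows "k \<ge> 1 \<Longrightarrow> integral\<^sup>L \<mu> (g (real (k * n))) \<le> real k * integral\<^sup>L \<mu> (g (real n))"
proof (induction k rule: nat_induct_at_least)
  case (Suc k)
  note p = invariant_borel_probs[OF \<mu>]
  have c: "continuous_on UNIV (\<lambda>q. g (real n) (\<phi> (real (k * n)) q))"
    using continuous_on_compose2[OF g_continuous flow_continuous] by auto
  have "integral\<^sup>L \<mu> (g (real (Suc k * n)))
      \<le> integral\<^sup>L \<mu> (\<lambda>q. g (real n) (\<phi> (real (k * n)) q) + g (real (k * n)) q)"
    using subadditive[of "real n" "real (k * n)"]
    by (intro integral_mono Bochner_Integration.integrable_add g_integrable[OF p]
        integrable_borel_probs[OF compact_space p c]) (auto simp: algebra_simps)
  also have "\<dots> = integral\<^sup>L \<mu> (\<lambda>q. g (real n) (\<phi> (real (k * n)) q)) + integral\<^sup>L \<mu> (g (real (k * n)))"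
    by (intro Bochner_Integration.integral_add g_integrable[OF p]
        integrable_borel_probs[OF compact_space p c]) auto
  also have "integral\<^sup>L \<mu> (\<lambda>q. g (real n) (\<phi> (real (k * n)) q)) = integral\<^sup>L \<mu> (g (real n))"
    by (rule invariant_integral[OF \<mu> _ g_continuous]) auto
  finally show ?case using Suc by (simp add: algebra_simps)
qed simp

text \<open>Demanding the bound at every \<open>n\<close>, not only asymptotically, expresses
  maximality by weakly closed conditions, since each \<open>g n\<close> is continuous.\<close>

definition maximizing :: "'m measure set" where
  "maximizing = {\<mu>. invariant_prob_measure \<phi> \<mu> \<and>
     (\<forall>n\<ge>1. real n * growth \<le> integral\<^sup>L \<mu> (g (real n)))}"

lemma maximizing_closed:
  assumes "\<And>k. \<mu>s k \<in> maximizing" "\<mu> \<in> borel_probs" and lim: "weak_limit \<mu>s \<mu>"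
  shows "\<mu> \<in> maximizing"
  unfolding maximizing_def
proof (intro CollectI conjI allI impI)
  show "invariant_prob_measure \<phi> \<mu>"
    using assms(1) by (intro invariant_weak_limit[OF _ assms(2) lim]) (simp add: maximizing_def)
  fix n :: nat assume "n \<ge> 1"
  have "(\<lambda>k. integral\<^sup>L (\<mu>s k) (g (real n))) \<longlonglongrightarrow> integral\<^sup>L \<mu> (g (real n))"
    using lim g_continuous[of "real n"] by (simp add: weak_limit_def)
  moreover have "real n * growth \<le> integral\<^sup>L (\<mu>s k) (g (real n))" for k
    using assms(1)[of k] \<open>n \<ge> 1\<close> by (simp add: maximizing_def)
  ultimately show "real n * growth \<le> integral\<^sup>L \<mu> (g (real n))"
    by (intro LIMSEQ_le_const) auto
qed

text \<open>
  No invariant measure has growth rate above \<open>growth\<close>, so a mixture attains it only if both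
  components do.
\<close>

lemma maximizing_face:
  assumes \<mu>: "\<mu> \<in> maximizing" and \<mu>12: "invariant_prob_measure \<phi> \<mu>1" "invariant_prob_measure \<phi> \<mu>2"
    and t: "0 < t" "t < 1" and mix: "mixture t \<mu>1 \<mu>2 \<mu>"
  shows "\<mu>1 \<in> maximizing"
proof (rule ccontr)
  assume "\<mu>1 \<notin> maximizing"
  then obtain N where N: "N \<ge> 1" "integral\<^sup>L \<mu>1 (g (real N)) < real N * growth"
    using \<mu>12 unfolding maximizing_def by force
  define \<delta> where "\<delta> = real N * growth - integral\<^sup>L \<mu>1 (g (real N))"
  have "\<delta> > 0" using N by (simp add: \<delta>_def)
  \<comment> \<open>The horizon \<open>n * N\<close> is cut into \<open>n\<close> blocks of length
    \<open>N\<close> for \<open>\<mu>1\<close>, which loses \<open>t * n * \<delta>\<close>, and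
    into \<open>N\<close> blocks of length \<open>n\<close> for \<open>\<mu>2\<close>. With this
    slack the second part gains at most \<open>(1 - t) * t * n * \<delta>\<close>, less than the
    loss.\<close>
  then have e: "t * \<delta> / real N > 0" using t N by simp
  obtain n where n: "n \<ge> 1" "sup_g n < real n * (growth + t * \<delta> / real N)"
    using growth_approx[OF e] .
  have "n * N \<ge> 1" using n(1) N(1) by simp
  then have "real (n * N) * growth \<le> integral\<^sup>L \<mu> (g (real (n * N)))"
    using \<mu> unfolding maximizing_def by blast
  also have "\<dots> = t * integral\<^sup>L \<mu>1 (g (real (n * N))) + (1 - t) * integral\<^sup>L \<mu>2 (g (real (n * N)))"
    using mix g_continuous[of "real (n * N)"] by (simp add: mixture_def)
  also have "\<dots> \<le> t * (real n * (real N * growth - \<delta>)) + (1 - t) * (real N * (real n * (growth + t * \<delta> / real N)))"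
  proof (intro add_mono mult_left_mono)
    show "integral\<^sup>L \<mu>1 (g (real (n * N))) \<le> real n * (real N * growth - \<delta>)"
      using integral_mult_le[OF \<mu>12(1) n(1), of N] by (simp add: \<delta>_def)
    interpret prob_space \<mu>2 using borel_probsD(1)[OF invariant_borel_probs[OF \<mu>12(2)]] .
    have "integral\<^sup>L \<mu>2 (g (real (n * N))) \<le> integral\<^sup>L \<mu>2 (\<lambda>_. sup_g (n * N))"
      by (intro integral_mono g_integrable invariant_borel_probs[OF \<mu>12(2)] g_le_sup_g) auto
    also have "\<dots> = sup_g (N * n)" by (simp add: prob_space mult.commute)
    also have "\<dots> \<le> real N * sup_g n" by (rule sup_g_mult_le[OF N(1)])
    also have "\<dots> \<le> real N * (real n * (growth + t * \<delta> / real N))"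
      using n(2) by (intro mult_left_mono) auto
    finally show "integral\<^sup>L \<mu>2 (g (real (n * N))) \<le> real N * (real n * (growth + t * \<delta> / real N))" .
  qed (use t in auto)
  also have "\<dots> = real (n * N) * growth - real n * t * t * \<delta>"
    using N(1) by (simp add: field_simps)
  finally have "real n * t * t * \<delta> \<le> 0" by simp
  moreover have "real n * t * t * \<delta> > 0" using n(1) t \<open>\<delta> > 0\<close> by simp
  ultimately show False by simp
qed

text \<open>
  With \<open>h u = g (N - u) (\<phi> u q)\<close>, subadditivity reads \<open>h u - h (u + n) \<le> g n (\<phi> u q)\<close>, and the
  integral of the left-hand side telescopes to boundary terms.
\<close>

lemma integral_time_average_ge:
  fixes n N :: nat
  assumes "1 \<le> n" "n \<le> N" and q: "real N * growth \<le> g (real N) q"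
    and L: "\<And>t q. 0 \<le> t \<Longrightarrow> t \<le> real n \<Longrightarrow> \<bar>g t q\<bar> \<le> L"
  shows "real n * growth - 3 * real n * L / real N \<le> integral\<^sup>L (time_average (real N) q) (g (real n))"
proof -
  define h where "h u = g (real N - u) (\<phi> u q)" for u
  define G where "G u = g (real n) (\<phi> u q)" for u
  have hc: "continuous_on {0..real N} h"
  proof -
    have "continuous_on {0..real N} (\<lambda>u. (\<lambda>(q, t). g t q) (\<phi> u q, real N - u))"
      by (rule continuous_on_compose2[OF continuous])
         (auto intro!: continuous_intros continuous_on_subset[OF flow_continuous_time])
    then show ?thesis by (simp add: h_def)
  qed
  have Gc: "continuous_on {0..real N} G"
    unfolding G_def by (rule continuous_on_subset[OF orbit_continuous[OF g_continuous]]) auto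
  have hi: "h integrable_on {x..y}" if "0 \<le> x" "y \<le> real N" for x y
    using continuous_on_subset[OF hc] that by (intro integrable_continuous_real) auto
  have Gi: "G integrable_on {x..y}" if "0 \<le> x" "y \<le> real N" for x y
    using continuous_on_subset[OF Gc] that by (intro integrable_continuous_real) auto
  let ?n = "real n" and ?N = "real N"
  have nN: "0 \<le> ?N - ?n" "0 \<le> ?n" using assms by auto
  have shift: "((\<lambda>u. h (u + ?n)) has_integral integral {?n..?N} h) {0..?N - ?n}"
    using has_integral_shift[of h 0 ?n "?N - ?n"] hi[of ?n ?N] nN by simp
  have "h u - h (u + ?n) \<le> G u" if "u \<in> {0..?N - ?n}" for u
  proof -
    have "g ((?N - (u + ?n)) + ?n) (\<phi> u q) \<le> g (?N - (u + ?n)) (\<phi> ?n (\<phi> u q)) + g ?n (\<phi> u q)"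
      using that by (intro subadditive) auto
    then show ?thesis using that flow_add[of ?n u q]
      by (simp add: h_def G_def add.commute algebra_simps)
  qed
  then have "integral {0..?N - ?n} (\<lambda>u. h u - h (u + ?n)) \<le> integral {0..?N - ?n} G"
    using shift hi[of 0 "?N - ?n"] Gi[of 0 "?N - ?n"] nN
    by (intro integral_le integrable_diff) auto
  moreover have "integral {0..?N - ?n} (\<lambda>u. h u - h (u + ?n)) =
      integral {0..?N - ?n} h - integral {?n..?N} h"
    using shift hi[of 0 "?N - ?n"] nN
    by (subst Henstock_Kurzweil_Integration.integral_diff) (auto simp: integral_unique)
  moreover have "integral {0..?N - ?n} h + integral {?N - ?n..?N} h = integral {0..?N} h"
    using nN by (intro Henstock_Kurzweil_Integration.integral_combine hi) auto
  moreover have "integral {0..?n} h + integral {?n..?N} h = integral {0..?N} h"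
    using nN by (intro Henstock_Kurzweil_Integration.integral_combine hi) auto
  moreover have "integral {0..?N - ?n} G + integral {?N - ?n..?N} G = integral {0..?N} G"
    using nN by (intro Henstock_Kurzweil_Integration.integral_combine Gi) auto
  moreover have "?n * (?N * growth - L) \<le> integral {0..?n} h"
  proof -
    have "?N * growth - L \<le> h u" if "u \<in> {0..?n}" for u
    proof -
      have "g (?N - u + u) q \<le> h u + g u q"
        using that nN unfolding h_def by (intro subadditive) auto
      then show ?thesis using q L[of u q] that by (simp add: abs_le_iff)
    qed
    then have "integral {0..?n} (\<lambda>_. ?N * growth - L) \<le> integral {0..?n} h"
      using nN by (intro integral_le hi) auto
    then show ?thesis by simp
  qed
  moreover have "integral {?N - ?n..?N} h \<le> ?n * L"
  proof -
    have "h u \<le> L" if "u \<in> {?N - ?n..?N}" for u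
      using L[of "?N - u" "\<phi> u q"] that by (auto simp: h_def abs_le_iff)
    then have "integral {?N - ?n..?N} h \<le> integral {?N - ?n..?N} (\<lambda>_. L)"
      using nN by (intro integral_le hi) auto
    then show ?thesis by simp
  qed
  moreover have "- (?n * L) \<le> integral {?N - ?n..?N} G"
  proof -
    have "- L \<le> G u" for u
      using L[of ?n "\<phi> u q"] by (auto simp: G_def abs_le_iff)
    then have "integral {?N - ?n..?N} (\<lambda>_. - L) \<le> integral {?N - ?n..?N} G"
      using nN by (intro integral_le Gi) auto
    then show ?thesis by simp
  qed
  \<comment> \<open>The main term \<open>n * N * growth\<close> comes from \<open>h\<close> on the
    first window of length \<open>n\<close>. Three losses of \<open>n * L\<close> occur: in bounding
    \<open>h\<close> from below there, \<open>h\<close> from above on the last window, and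
    \<open>G\<close> from below on the last window.\<close>
  ultimately have "?n * (?N * growth - L) - ?n * L - ?n * L \<le> integral {0..?N} G" by linarith
  then have "(?n * (?N * growth - L) - ?n * L - ?n * L) / ?N \<le> integral {0..?N} G / ?N"
    using assms by (intro divide_right_mono) auto
  moreover have "(?n * (?N * growth - L) - ?n * L - ?n * L) / ?N = ?n * growth - 3 * ?n * L / ?N"
    using assms by (simp add: field_simps)
  ultimately show ?thesis
    using integral_time_average[of ?N "g ?n" q] g_continuous[of ?n] assms by (simp add: G_def[abs_def])
qed

lemma maximizing_nonempty: "maximizing \<noteq> {}"
proof -
  have "\<exists>q. real (Suc k) * growth \<le> g (real (Suc k)) q" for k
    using growth_le[of "Suc k"] sup_g_attained[of "Suc k"] by (metis le_add1 plus_1_eq_Suc)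
  then obtain qs where qs: "\<And>k. real (Suc k) * growth \<le> g (real (Suc k)) (qs k)" by metis
  define \<mu>s where "\<mu>s k = time_average (real (Suc k)) (qs k)" for k
  have "\<mu>s k \<in> borel_probs" for k unfolding \<mu>s_def by (rule time_average_borel_probs) simp
  then obtain r \<mu> where r: "strict_mono r" and \<mu>: "\<mu> \<in> borel_probs" and lim: "weak_limit (\<mu>s \<circ> r) \<mu>"
    using borel_probs_weakly_compact[OF compact_space, of \<mu>s] by blast
  have r_top: "filterlim (\<lambda>k. real (Suc (r k))) at_top sequentially"
    using filterlim_subseq[OF r]
    by (intro filterlim_compose[OF filterlim_real_sequentially] filterlim_compose[OF filterlim_Suc])
  have "invariant_prob_measure \<phi> \<mu>"
    using lim by (intro invariant_weak_limit_time_average[OF _ r_top \<mu>, of "qs \<circ> r"])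
      (auto simp: \<mu>s_def o_def)
  moreover have "real n * growth \<le> integral\<^sup>L \<mu> (g (real n))" if n: "n \<ge> 1" for n
  proof -
    \<comment> \<open>\<open>L\<close> depends on \<open>n\<close> but not on \<open>k\<close>, so
      the boundary error vanishes as the horizon grows.\<close>
    obtain L where L: "\<And>t q. 0 \<le> t \<Longrightarrow> t \<le> real n \<Longrightarrow> \<bar>g t q\<bar> \<le> L" using g_bounded by metis
    have "(\<lambda>k. integral\<^sup>L (\<mu>s (r k)) (g (real n))) \<longlonglongrightarrow> integral\<^sup>L \<mu> (g (real n))"
      using lim g_continuous[of "real n"] by (simp add: weak_limit_def)
    moreover have "(\<lambda>k. real n * growth - 3 * real n * L / real (Suc (r k))) \<longlonglongrightarrow> real n * growth - 0"
      by (intro tendsto_diff tendsto_const real_tendsto_divide_at_top[OF tendsto_const r_top])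
    moreover have "real n * growth - 3 * real n * L / real (Suc (r k)) \<le> integral\<^sup>L (\<mu>s (r k)) (g (real n))"
      if "k \<ge> n" for k
    proof -
      have "n \<le> Suc (r k)" using that seq_suble[OF r, of k] by linarith
      then show ?thesis unfolding \<mu>s_def by (intro integral_time_average_ge n qs L)
    qed
    ultimately show ?thesis using LIMSEQ_le[of _ "real n * growth - 0"] by fastforce
  qed
  ultimately show ?thesis by (auto simp: maximizing_def)
qed

theorem ergodic_nonneg_exists:
  obtains \<mu> where "\<mu> \<in> ergodic_measures \<phi>" "\<And>n. n \<ge> 1 \<Longrightarrow> 0 \<le> integral\<^sup>L \<mu> (g (real n))"
proof -
  obtain \<mu> where \<mu>: "\<mu> \<in> maximizing" "\<mu> \<in> ergodic_measures \<phi>"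
  proof (rule ergodic_in_face_exists[OF maximizing_nonempty])
    show "invariant_prob_measure \<phi> \<mu>" if "\<mu> \<in> maximizing" for \<mu>
      using that by (simp add: maximizing_def)
    show "\<mu> \<in> maximizing" if "\<And>k. \<mu>s k \<in> maximizing" "\<mu> \<in> borel_probs" "weak_limit \<mu>s \<mu>" for \<mu>s \<mu>
      by (rule maximizing_closed[OF that])
    show "\<mu>1 \<in> maximizing" if "\<mu> \<in> maximizing" "invariant_prob_measure \<phi> \<mu>1"
      "invariant_prob_measure \<phi> \<mu>2" "0 < t" "t < 1" "mixture t \<mu>1 \<mu>2 \<mu>" for \<mu> \<mu>1 \<mu>2 t
      by (rule maximizing_face[OF that])
  qed (rule that)
  have "0 \<le> integral\<^sup>L \<mu> (g (real n))" if "n \<ge> 1" for n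
  proof -
    have "0 \<le> real n * growth" using growth_nonneg by simp
    also have "\<dots> \<le> integral\<^sup>L \<mu> (g (real n))" using \<mu>(1) that by (simp add: maximizing_def)
    finally show ?thesis .
  qed
  with \<mu>(2) show thesis by (rule that)
qed

end

section \<open>Datko's argument\<close>

text \<open>
  The tails \<open>R n = \<Sum>i\<ge>n. u i\<close> satisfy \<open>R (n + 1) = R n - u n \<le> (1 - 1 / C n) R n\<close>.
\<close>

lemma discrete_datko:
  fixes u C :: "nat \<Rightarrow> real"
  assumes u: "\<And>j. u j \<ge> 0" and C: "\<And>j. C j > 0"
    and tail: "\<And>j m. (\<Sum>i<m. u (i + j)) \<le> C j * u j"
  shows "u n \<le> C 0 * u 0 * exp (- (\<Sum>j<n. 1 / C j))"
proof -
  have summ: "summable u"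
    using tail[of 0] u by (intro summableI_nonneg_bounded[of u "C 0 * u 0"]) auto
  have summ': "summable (\<lambda>i. u (i + j))" for j by (rule summable_ignore_initial_segment[OF summ])
  define R where "R j = (\<Sum>i. u (i + j))" for j
  have R_le: "R j \<le> C j * u j" for j
    unfolding R_def by (rule suminf_le_const[OF summ' tail])
  have R0: "R j \<ge> 0" for j unfolding R_def using u summ' by (intro suminf_nonneg) auto
  have R_Suc: "R j = u j + R (Suc j)" for j
    using suminf_split_initial_segment[OF summ'[of j], of 1] by (simp add: R_def)
  have "R n \<le> R 0 * exp (- (\<Sum>j<n. 1 / C j))"
  proof (induction n)
    case (Suc n)
    have "R n / C n \<le> u n" using R_le[of n] C[of n] by (simp add: field_simps)
    then have "R (Suc n) \<le> R n - R n / C n" using R_Suc[of n] by linarith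
    also have "\<dots> = R n * (1 - 1 / C n)" by (simp add: algebra_simps)
    \<comment> \<open>\<open>1 - x \<le> exp (- x)\<close> holds for all real \<open>x\<close>, so
      no lower bound on \<open>C n\<close> beyond positivity enters.\<close>
    also have "\<dots> \<le> R n * exp (- (1 / C n))"
      using R0 exp_ge_add_one_self[of "- (1 / C n)"] by (intro mult_left_mono) auto
    also have "\<dots> \<le> R 0 * exp (- (\<Sum>j<n. 1 / C j)) * exp (- (1 / C n))"
      by (intro mult_right_mono Suc) auto
    finally show ?case by (simp add: exp_add exp_diff exp_minus field_simps)
  qed simp
  moreover have "u n \<le> R n" using R_Suc[of n] R0[of "Suc n"] by simp
  moreover have "R 0 * exp (- (\<Sum>j<n. 1 / C j)) \<le> C 0 * u 0 * exp (- (\<Sum>j<n. 1 / C j))"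
    by (intro mult_right_mono R_le) auto
  ultimately show ?thesis by linarith
qed

section \<open>Norms of a continuous cocycle over a compact base\<close>

locale compact_cocycle = compact_semiflow \<phi> for \<phi> :: "real \<Rightarrow> 'm::metric_space \<Rightarrow> 'm" +
  fixes A :: "'m \<Rightarrow> real \<Rightarrow> ('x::real_normed_vector \<Rightarrow>\<^sub>L 'x)"
  assumes cocycle: "continuous_cocycle \<phi> A"
begin

lemma A_0: "A q 0 = id_blinfun"
  and A_add: "t \<ge> 0 \<Longrightarrow> s \<ge> 0 \<Longrightarrow> A q (t + s) = A (\<phi> s q) t o\<^sub>L A q s"
  and A_joint: "continuous_on (UNIV \<times> {0..}) (\<lambda>(q, t). A q t)"
  using cocycle unfolding continuous_cocycle_def cocycle_def by auto

lemma A_continuous_space: "t \<ge> 0 \<Longrightarrow> continuous_on UNIV (\<lambda>q. A q t)"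
proof -
  assume "t \<ge> 0"
  then have "continuous_on UNIV (\<lambda>q. (\<lambda>(q, t). A q t) (q, t))"
    by (intro continuous_on_compose2[OF A_joint]) (auto intro!: continuous_intros)
  then show ?thesis by simp
qed

lemma A_continuous_time: "continuous_on {0..} (\<lambda>t. A q t)"
proof -
  have "continuous_on {0..} (\<lambda>t. (\<lambda>(q, t). A q t) (q, t))"
    by (intro continuous_on_compose2[OF A_joint]) (auto intro!: continuous_intros)
  then show ?thesis by simp
qed

lemma norm_A_add: "t \<ge> 0 \<Longrightarrow> s \<ge> 0 \<Longrightarrow> norm (A q (t + s)) \<le> norm (A (\<phi> s q) t) * norm (A q s)"
  by (simp add: A_add norm_blinfun_compose)

lemma norm_A_bounded:
  obtains B where "B \<ge> 1" "\<And>q t. 0 \<le> t \<Longrightarrow> t \<le> T \<Longrightarrow> norm (A q t) \<le> B"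
proof -
  have "compact ((UNIV :: 'm set) \<times> {0..T})" by (intro compact_Times compact_space) auto
  then have "compact ((\<lambda>(q, t). A q t) ` (UNIV \<times> {0..T}))"
    by (rule compact_continuous_image[OF continuous_on_subset[OF A_joint], rotated]) auto
  then have "bounded ((\<lambda>(q, t). A q t) ` (UNIV \<times> {0..T}))" by (rule compact_imp_bounded)
  then obtain B where B: "\<forall>x\<in>(\<lambda>(q, t). A q t) ` (UNIV \<times> {0..T}). norm x \<le> B"
    unfolding bounded_iff by blast
  have "norm (A q t) \<le> max 1 B" if "0 \<le> t" "t \<le> T" for t q
    using bspec[OF B, of "A q t"] that by force
  then show thesis by (intro that[of "max 1 B"]) auto
qed

text \<open>Truncating below at \<open>exp (- t)\<close> keeps the logarithm finite and continuous.\<close>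

definition lognorm :: "real \<Rightarrow> 'm \<Rightarrow> real" where
  "lognorm t q = ln (max (norm (A q t)) (exp (- t)))"

lemma lognorm_continuous: "continuous_on (UNIV \<times> {0..}) (\<lambda>(q, t). lognorm t q)"
proof -
  have "continuous_on (UNIV \<times> {0..}) (\<lambda>z. ln (max (norm ((\<lambda>(q, t). A q t) z)) (exp (- snd z))))"
    using A_joint by (intro continuous_intros) (auto simp: max_def)
  then show ?thesis by (simp add: lognorm_def split_beta)
qed

text \<open>The floor \<open>exp (- t)\<close> turns sums of times into products, so the truncated
  norm inherits submultiplicativity from the cocycle.\<close>

lemma lognorm_subadditive:
  assumes "t \<ge> 0" "s \<ge> 0"
  shows "lognorm (t + s) q \<le> lognorm t (\<phi> s q) + lognorm s q"
proof -
  let ?x = "max (norm (A (\<phi> s q) t)) (exp (- t))" and ?y = "max (norm (A q s)) (exp (- s))"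
  have pos: "?x > 0" "?y > 0" by (auto simp: less_max_iff_disj)
  have "norm (A q (t + s)) \<le> norm (A (\<phi> s q) t) * norm (A q s)" by (rule norm_A_add[OF assms])
  also have "\<dots> \<le> ?x * ?y" using pos by (intro mult_mono) auto
  finally have 1: "norm (A q (t + s)) \<le> ?x * ?y" .
  have "exp (- (t + s)) = exp (- t) * exp (- s)" by (simp add: exp_add exp_diff exp_minus field_simps)
  also have "\<dots> \<le> ?x * ?y" using pos by (intro mult_mono) auto
  finally have "max (norm (A q (t + s))) (exp (- (t + s))) \<le> ?x * ?y" using 1 by simp
  then have "lognorm (t + s) q \<le> ln (?x * ?y)"
    unfolding lognorm_def using pos by (subst ln_le_cancel_iff) (auto simp: less_max_iff_disj)
  then show ?thesis using pos by (simp add: lognorm_def ln_mult)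
qed

text \<open>Compactness upgrades a pointwise contraction at one time \<open>n\<close> to a common
  factor \<open>\<theta> < 1\<close>, which is then iterated along orbits in blocks of length
  \<open>n\<close>.\<close>

lemma uniformly_exp_stable_if_contracting:
  assumes n: "n \<ge> 1" and neg: "\<And>q. lognorm (real n) q < 0"
  shows "uniformly_exp_stable A"
proof -
  obtain q0 where q0: "\<And>q. norm (A q (real n)) \<le> norm (A q0 (real n))"
    using continuous_attains_sup[OF compact_space UNIV_not_empty
        continuous_on_norm[OF A_continuous_space[of "real n"]]] by auto
  \<comment> \<open>The norm may vanish at time \<open>n\<close>; the cutoff 1/2 keeps
    \<open>ln \<theta>\<close> and the division by \<open>\<theta>\<close> meaningful.\<close>
  define \<theta> where "\<theta> = max (norm (A q0 (real n))) (1/2)"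
  have "norm (A q0 (real n)) < 1"
    using neg[of q0] by (simp add: lognorm_def less_max_iff_disj)
  then have \<theta>: "0 < \<theta>" "\<theta> < 1" and A\<theta>: "\<And>q. norm (A q (real n)) \<le> \<theta>"
    using q0 by (auto simp: \<theta>_def intro: order_trans max.coboundedI1)
  obtain B where B: "B \<ge> 1" "\<And>q t. 0 \<le> t \<Longrightarrow> t \<le> real n \<Longrightarrow> norm (A q t) \<le> B"
    using norm_A_bounded by blast
  have iter: "norm (A q (real k * real n + r)) \<le> \<theta> ^ k * B" if "0 \<le> r" "r \<le> real n" for q r k
  proof (induction k)
    case (Suc k)
    have "norm (A q (real n + (real k * real n + r)))
        \<le> norm (A (\<phi> (real k * real n + r) q) (real n)) * norm (A q (real k * real n + r))"
      using that by (intro norm_A_add) auto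
    also have "\<dots> \<le> \<theta> * (\<theta> ^ k * B)" using Suc \<theta> by (intro mult_mono A\<theta>) auto
    finally show ?case by (simp add: algebra_simps)
  qed (use B that in simp)
  define \<kappa> where "\<kappa> = - ln \<theta> / real n"
  have "\<kappa> > 0" using \<theta> n by (simp add: \<kappa>_def divide_neg_pos)
  have "norm (A q t) \<le> (B / \<theta>) * exp (- \<kappa> * t)" if "t \<ge> 0" for q t
  proof -
    define k where "k = nat \<lfloor>t / real n\<rfloor>"
    have k: "real k \<le> t / real n" "t / real n < real k + 1"
      using that n unfolding k_def by (simp_all add: floor_less_iff)
    define r where "r = t - real k * real n"
    have r: "0 \<le> r" "r \<le> real n" using k n by (auto simp: r_def field_simps)
    have "norm (A q t) \<le> \<theta> ^ k * B" using iter[OF r, of q k] by (simp add: r_def)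
    also have "\<theta> ^ k = exp (real k * ln \<theta>)" using \<theta> by (simp add: exp_of_nat_mult)
    \<comment> \<open>Since \<open>k > t / n - 1\<close> and \<open>ln \<theta> < 0\<close>, the
      incomplete last block costs the factor \<open>1 / \<theta>\<close>.\<close>
    also have "\<dots> \<le> exp ((t / real n - 1) * ln \<theta>)"
      using k \<theta> by (auto intro!: mult_right_mono_neg)
    also have "\<dots> = exp (- \<kappa> * t) / \<theta>" using \<theta> by (simp add: \<kappa>_def algebra_simps exp_diff)
    finally show ?thesis using B(1) by (simp add: field_simps)
  qed
  moreover have "B / \<theta> > 0" using B \<theta> by simp
  ultimately show ?thesis unfolding uniformly_exp_stable_def using \<open>\<kappa> > 0\<close> by blast
qed

section \<open>From the integral bound to decay along orbits\<close>

lemma powr_orbit_continuous: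
  "p > 0 \<Longrightarrow> continuous_on {0..} (\<lambda>t. norm (blinfun_apply (A q t) x) powr p)"
  using A_continuous_time[of q] by (intro continuous_on_powr' continuous_intros) auto

text \<open>The norm at the right end of a unit interval is at most \<open>K\<close> times the norm
  at any point of that interval, so its power is controlled by the integral over it. For this reason
  the sum starts at time 1.\<close>

lemma sum_powr_orbit_le_integral:
  assumes p: "p > 0" and K: "K \<ge> 1" "\<And>q t. 0 \<le> t \<Longrightarrow> t \<le> 1 \<Longrightarrow> norm (A q t) \<le> K"
  shows "(\<Sum>i<n. norm (blinfun_apply (A q (real (Suc i))) x) powr p)
    \<le> K powr p * integral {0..real n} (\<lambda>t. norm (blinfun_apply (A q t) x) powr p)"
proof -
  let ?F = "\<lambda>t. norm (blinfun_apply (A q t) x) powr p"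
  have int: "?F integrable_on {a..b}" if "a \<ge> 0" for a b
    using continuous_on_subset[OF powr_orbit_continuous[OF p]] that
    by (intro integrable_continuous_real) auto
  show ?thesis
  proof (induction n)
    case (Suc n)
    have "?F (real (Suc n)) \<le> K powr p * ?F t" if t: "t \<in> {real n..real (Suc n)}" for t
    proof -
      have "A q ((real (Suc n) - t) + t) = A (\<phi> t q) (real (Suc n) - t) o\<^sub>L A q t"
        using t by (intro A_add) auto
      then have "norm (blinfun_apply (A q (real (Suc n))) x)
          \<le> norm (A (\<phi> t q) (real (Suc n) - t)) * norm (blinfun_apply (A q t) x)"
        using norm_blinfun[of "A (\<phi> t q) (real (Suc n) - t)" "blinfun_apply (A q t) x"] by simp
      also have "\<dots> \<le> K * norm (blinfun_apply (A q t) x)"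
        using t by (intro mult_right_mono K) auto
      finally show ?thesis using p K(1) by (simp add: powr_mono2 flip: powr_mult)
    qed
    then have "integral {real n..real (Suc n)} (\<lambda>_. ?F (real (Suc n)))
        \<le> integral {real n..real (Suc n)} (\<lambda>t. K powr p * ?F t)"
      using integrable_cmul[OF int[of "real n" "real (Suc n)"], of "K powr p"]
      by (intro integral_le) auto
    then have "?F (real (Suc n)) \<le> K powr p * integral {real n..real (Suc n)} ?F" by simp
    moreover have "integral {0..real (Suc n)} ?F = integral {0..real n} ?F + integral {real n..real (Suc n)} ?F"
      by (intro Henstock_Kurzweil_Integration.integral_combine[symmetric] int) auto
    ultimately show ?case using Suc by (simp add: distrib_left)
  qed simp
qed

text \<open>Time 0 has no preceding unit interval; its term \<open>norm x powr p\<close> accounts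
  for the summand 1 in the constant.\<close>

lemma sum_powr_orbit_le:
  fixes c :: real
  assumes p: "p > 0" and K: "K \<ge> 1" "\<And>q t. 0 \<le> t \<Longrightarrow> t \<le> 1 \<Longrightarrow> norm (A q t) \<le> K"
    and c: "c > 0" and int: "set_integrable lborel {0..} (\<lambda>t. norm (blinfun_apply (A q t) x) powr p)"
    and datko: "(LINT t:{0..}|lborel. norm (blinfun_apply (A q t) x) powr p) powr (1 / p) \<le> c * norm x"
  shows "(\<Sum>i<n. norm (blinfun_apply (A q (real i)) x) powr p) \<le> (1 + (K * c) powr p) * norm x powr p"
proof (cases n)
  case (Suc m)
  let ?F = "\<lambda>t. norm (blinfun_apply (A q t) x) powr p"
  let ?I = "LINT t:{0..}|lborel. ?F t"
  have I0: "?I \<ge> 0" unfolding set_lebesgue_integral_def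
    by (intro Bochner_Integration.integral_nonneg) (auto simp: indicator_def)
  have sub: "set_integrable lborel {0..real m} ?F"
    by (rule set_integrable_subset[OF int]) auto
  have "integral {0..real m} ?F = (LINT t:{0..real m}|lborel. ?F t)"
    by (rule set_borel_integral_eq_integral(2)[OF sub, symmetric])
  also have "\<dots> \<le> ?I"
    using sub int unfolding set_lebesgue_integral_def set_integrable_def
    by (intro integral_mono) (auto simp: indicator_def)
  also have "?I = (?I powr (1 / p)) powr p" using p I0 by (simp add: powr_powr)
  also have "\<dots> \<le> (c * norm x) powr p" using p by (intro powr_mono2 datko) auto
  finally have "K powr p * integral {0..real m} ?F \<le> K powr p * (c * norm x) powr p"
    by (intro mult_left_mono) auto
  also have "\<dots> = (K * c) powr p * norm x powr p"
    using K(1) c by (simp add: powr_mult mult.assoc)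
  finally have "(\<Sum>i<m. ?F (real (Suc i))) \<le> (K * c) powr p * norm x powr p"
    using sum_powr_orbit_le_integral[OF p K, where n = m and q = q and x = x] by linarith
  then show ?thesis unfolding Suc sum.lessThan_Suc_shift by (simp add: A_0 algebra_simps)
qed simp

text \<open>By the cocycle identity, the tail sum from time \<open>j\<close> is a full sum at the
  base point \<open>\<phi> j q\<close> for the vector \<open>A q j x\<close>. The bound at that
  point is thus the tail hypothesis of \<open>discrete_datko\<close>; taking \<open>p\<close>-th
  roots produces the factors \<open>1 / p\<close>.\<close>

lemma norm_A_decay:
  fixes c :: "'m \<Rightarrow> real"
  assumes p: "p > 0" and c: "\<And>q. c q \<ge> 1" and orbit: "\<And>j::nat. \<phi> (real j) q \<in> E"
    and sum: "\<And>q x n. q \<in> E \<Longrightarrow>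
      (\<Sum>i<n. norm (blinfun_apply (A q (real i)) x) powr p) \<le> c q * norm x powr p"
  shows "norm (A q (real n)) \<le> exp (ln (c q) / p - (\<Sum>j<n. 1 / (p * c (\<phi> (real j) q))))"
proof (rule norm_blinfun_bound)
  fix x
  let ?S = "\<Sum>j<n. 1 / c (\<phi> (real j) q)"
  let ?u = "\<lambda>j. norm (blinfun_apply (A q (real j)) x) powr p"
  have "?u n \<le> c (\<phi> (real 0) q) * ?u 0 * exp (- ?S)"
  proof (rule discrete_datko)
    fix j m :: nat
    have "A q (real (i + j)) = A (\<phi> (real j) q) (real i) o\<^sub>L A q (real j)" for i
      using A_add[of "real i" "real j" q] by simp
    moreover have "(\<Sum>i<m. norm (blinfun_apply (A (\<phi> (real j) q) (real i)) (blinfun_apply (A q (real j)) x)) powr p)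
        \<le> c (\<phi> (real j) q) * ?u j"
      by (rule sum[OF orbit])
    ultimately show "(\<Sum>i<m. ?u (i + j)) \<le> c (\<phi> (real j) q) * ?u j" by simp
  qed (use c in \<open>auto intro: less_le_trans[OF zero_less_one]\<close>)
  also have "\<dots> = (c q * exp (- ?S)) * norm x powr p" by (simp add: flow_0 A_0 algebra_simps)
  also have "c q * exp (- ?S) = exp (ln (c q) - ?S)"
    using c[of q] by (simp add: exp_diff exp_minus field_simps)
  also have "\<dots> = exp (ln (c q) / p - ?S / p) powr p"
    using p by (simp add: powr_def algebra_simps)
  also have "\<dots> * norm x powr p = (exp (ln (c q) / p - ?S / p) * norm x) powr p"
    by (simp add: powr_mult)
  finally have "norm (blinfun_apply (A q (real n)) x) \<le> exp (ln (c q) / p - ?S / p) * norm x"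
    using p by (metis exp_ge_zero mult_nonneg_nonneg norm_ge_zero not_le powr_less_mono2)
  then show "norm (blinfun_apply (A q (real n)) x)
      \<le> exp (ln (c q) / p - (\<Sum>j<n. 1 / (p * c (\<phi> (real j) q)))) * norm x"
    by (simp add: sum_divide_distrib mult.commute)
qed simp

theorem datko_imp_uniformly_exp_stable:
  fixes C :: "'m \<Rightarrow> real"
  assumes Cm: "C \<in> borel_measurable borel" and Cpos: "\<And>q. C q > 0" and E: "full_measure \<phi> E"
    and p: "p > 0"
    and int: "\<And>q x. q \<in> E \<Longrightarrow> set_integrable lborel {0..} (\<lambda>t. norm (blinfun_apply (A q t) x) powr p)"
    and datko: "\<And>q x. q \<in> E \<Longrightarrow>
      (LINT t:{0..}|lborel. norm (blinfun_apply (A q t) x) powr p) powr (1 / p) \<le> C q * norm x"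
  shows "uniformly_exp_stable A"
proof (rule ccontr)
  assume unstable: "\<not> uniformly_exp_stable A"
  interpret subadditive_family \<phi> lognorm
  proof
    show "\<exists>q. 0 \<le> lognorm (real n) q" if "n \<ge> 1" for n :: nat
      using uniformly_exp_stable_if_contracting[OF that] unstable by (meson not_le)
  qed (fact lognorm_continuous lognorm_subadditive)+
  obtain \<mu> where \<mu>: "\<mu> \<in> ergodic_measures \<phi>"
    and ge: "\<And>n. n \<ge> 1 \<Longrightarrow> 0 \<le> integral\<^sup>L \<mu> (lognorm (real n))"
    using ergodic_nonneg_exists by blast
  have inv: "invariant_prob_measure \<phi> \<mu>" using \<mu> by (simp add: ergodic_measures_def)
  note \<mu>p = invariant_borel_probs[OF inv]
  interpret prob_space \<mu> by (rule borel_probsD[OF \<mu>p])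
  note sets_\<mu>[measurable_cong] = borel_probsD(2)[OF \<mu>p]
  obtain K where K: "K \<ge> 1" "\<And>q t. 0 \<le> t \<Longrightarrow> t \<le> 1 \<Longrightarrow> norm (A q t) \<le> K"
    using norm_A_bounded by blast
  define c where "c q = 1 + (K * C q) powr p" for q
  define w where "w q = min 1 (1 / (p * c q))" for q
  define b where "b q = ln (c q) / p" for q
  have c1: "c q \<ge> 1" for q by (simp add: c_def)
  have cm[measurable]: "c \<in> borel_measurable borel"
    using Cm unfolding c_def[abs_def] by measurable
  have wm[measurable]: "w \<in> borel_measurable borel" unfolding w_def[abs_def] by measurable
  have bm[measurable]: "b \<in> borel_measurable borel" unfolding b_def[abs_def] by measurable
  have w: "0 < w q" "w q \<le> 1" for q
    using p c1[of q] by (auto simp: w_def)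
  have b0: "0 \<le> b q" for q using p c1[of q] by (simp add: b_def)
  have flow_m[measurable]: "\<phi> (real j) \<in> borel \<rightarrow>\<^sub>M borel" for j
    by (rule borel_measurable_continuous_onI[OF flow_continuous]) simp
  \<comment> \<open>\<open>E\<close> need not be invariant. Invariance of \<open>\<mu>\<close> gives
    each preimage of \<open>E\<close> full measure, and restricting to integer times leaves
    countably many conditions.\<close>
  have orbit_E: "AE q in \<mu>. \<forall>j::nat. \<phi> (real j) q \<in> E"
  proof (subst AE_all_countable, rule allI)
    fix j :: nat
    have Em: "E \<in> sets borel" and "emeasure \<mu> E = 1"
      using E \<mu> by (auto simp: full_measure_def)
    then have "emeasure \<mu> (\<phi> (real j) -` E) = 1"
      using inv by (simp add: invariant_prob_measure_def)
    moreover have "\<phi> (real j) -` E \<in> sets \<mu>"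
      using measurable_sets_borel[OF flow_m Em] sets_\<mu> by simp
    ultimately have "AE q in \<mu>. q \<in> \<phi> (real j) -` E"
      by (subst AE_in_set_eq_1) (auto simp: emeasure_eq_measure)
    then show "AE q in \<mu>. \<phi> (real j) q \<in> E" by simp
  qed
  define L where "L = ln K"
  have L0: "L \<ge> 0" using K(1) by (simp add: L_def)
  have upper: "lognorm (real n) q \<le> real n * L" if "n \<ge> 1" for n q
  proof -
    have "norm (A q (real n)) \<le> K ^ n" for n q
    proof (induction n)
      case 0
      show ?case using norm_blinfun_id_le by (simp add: A_0)
    next
      case (Suc n)
      have "norm (A q (1 + real n)) \<le> norm (A (\<phi> (real n) q) 1) * norm (A q (real n))"
        by (rule norm_A_add) auto
      also have "\<dots> \<le> K * K ^ n" using Suc K by (intro mult_mono) auto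
      finally show ?case by simp
    qed
    moreover have "exp (- real n) \<le> K ^ n"
      using K(1) one_le_power[of K n] by (meson exp_le_one_iff neg_le_0_iff_le of_nat_0_le_iff order_trans)
    ultimately have "lognorm (real n) q \<le> ln (K ^ n)"
      unfolding lognorm_def using K(1) by (subst ln_le_cancel_iff) (auto simp: less_max_iff_disj)
    then show ?thesis using K(1) by (simp add: L_def ln_realpow)
  qed
  have key: "AE q in \<mu>. lognorm (real n) q + (\<Sum>j<n. w (\<phi> (real j) q)) \<le> min (b q) (real n * (L + 1))"
    if "n \<ge> 1" for n
    using orbit_E
  proof eventually_elim
    fix q assume orbit: "\<forall>j::nat. \<phi> (real j) q \<in> E"
    let ?S = "\<Sum>j<n. w (\<phi> (real j) q)"
    have "?S \<le> (\<Sum>j<n. 1)" by (intro sum_mono w)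
    then have Sn: "?S \<le> real n" by simp
    have sum: "(\<Sum>i<n. norm (blinfun_apply (A q (real i)) x) powr p) \<le> c q * norm x powr p"
      if "q \<in> E" for q x n
      unfolding c_def by (rule sum_powr_orbit_le[OF p K Cpos int[OF that] datko[OF that]])
    have "norm (A q (real n)) \<le> exp (b q - (\<Sum>j<n. 1 / (p * c (\<phi> (real j) q))))"
      unfolding b_def using orbit sum by (intro norm_A_decay[where c = c and E = E, OF p c1]) (blast, blast)
    also have "\<dots> \<le> exp (b q - ?S)" by (auto intro!: sum_mono simp: w_def)
    finally have "norm (A q (real n)) \<le> exp (b q - ?S)" .
    \<comment> \<open>The cap on \<open>w\<close> enters here: \<open>?S \<le> n\<close> and
      \<open>b q \<ge> 0\<close> put the bound above the floor built into
      \<open>lognorm\<close>.\<close>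
    moreover have "exp (- real n) \<le> exp (b q - ?S)" using Sn b0[of q] by simp
    ultimately have "lognorm (real n) q \<le> b q - ?S"
      unfolding lognorm_def by (subst ln_le_cancel_iff[of _ "exp _", simplified]) (auto simp: less_max_iff_disj)
    moreover have "lognorm (real n) q + ?S \<le> real n * (L + 1)"
      using upper[OF that, of q] Sn by (simp add: algebra_simps)
    ultimately show "lognorm (real n) q + ?S \<le> min (b q) (real n * (L + 1))" by simp
  qed
  have wi: "integrable \<mu> (\<lambda>q. w (\<phi> (real j) q))" for j
    using w by (intro integrable_const_bound[of _ 1]) (auto simp: less_imp_le)
  have w_eq: "(\<integral>q. w (\<phi> (real j) q) \<partial>\<mu>) = integral\<^sup>L \<mu> w" for j
    using integral_distr[of "\<phi> (real j)" \<mu> borel w] invariant_distr[OF inv, of "real j"] by simp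
  have le: "integral\<^sup>L \<mu> w \<le> (\<integral>q. min (b q / real n) (L + 1) \<partial>\<mu>)" if n: "n \<ge> 1" for n
  proof -
    have mi: "integrable \<mu> (\<lambda>q. min (b q) (real n * (L + 1)))"
      using b0 L0 by (intro integrable_const_bound[of _ "real n * (L + 1)"]) auto
    note gi = g_integrable[OF \<mu>p, of "real n"]
    have "0 + real n * integral\<^sup>L \<mu> w \<le> integral\<^sup>L \<mu> (lognorm (real n)) + (\<Sum>j<n. \<integral>q. w (\<phi> (real j) q) \<partial>\<mu>)"
      unfolding w_eq using ge[OF n] by simp
    also have "\<dots> = (\<integral>q. lognorm (real n) q + (\<Sum>j<n. w (\<phi> (real j) q)) \<partial>\<mu>)"
      using gi wi by simp
    also have "\<dots> \<le> (\<integral>q. min (b q) (real n * (L + 1)) \<partial>\<mu>)"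
      using key[OF n] gi wi mi by (intro integral_mono_AE) auto
    also have "\<dots> = (\<integral>q. real n * min (b q / real n) (L + 1) \<partial>\<mu>)"
      using n by (intro Bochner_Integration.integral_cong) (auto simp: min_def field_simps)
    finally show ?thesis using n by simp
  qed
  have "(\<lambda>n. \<integral>q. min (b q / real n) (L + 1) \<partial>\<mu>) \<longlonglongrightarrow> (\<integral>q. 0 \<partial>\<mu>)"
  proof (rule integral_dominated_convergence[where w = "\<lambda>_. L + 1"])
    show "AE q in \<mu>. (\<lambda>n. min (b q / real n) (L + 1)) \<longlonglongrightarrow> 0"
    proof (rule AE_I2)
      fix q
      have "(\<lambda>n. min (b q / real n) (L + 1)) \<longlonglongrightarrow> min 0 (L + 1)"
        by (intro tendsto_min tendsto_const lim_const_over_n)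
      then show "(\<lambda>n. min (b q / real n) (L + 1)) \<longlonglongrightarrow> 0" using L0 by (simp add: min_def)
    qed
    show "AE q in \<mu>. norm (min (b q / real n) (L + 1)) \<le> L + 1" for n
      using b0 L0 by (intro AE_I2) auto
  qed auto
  then have "integral\<^sup>L \<mu> w \<le> 0"
    using le by (intro LIMSEQ_le_const[of _ 0]) auto
  moreover have "integral\<^sup>L \<mu> w > 0"
  proof -
    have wint: "integrable \<mu> w" using w by (intro integrable_const_bound[of _ 1]) (auto simp: less_imp_le)
    have "integral\<^sup>L \<mu> w \<noteq> 0"
      using integral_nonneg_eq_0_iff_AE[OF wint] w AE_E_prob[of "\<lambda>_. False"]
      by (auto simp: less_imp_le less_imp_neq[symmetric])
    moreover have "integral\<^sup>L \<mu> w \<ge> 0" using w by (simp add: less_imp_le)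
    ultimately show ?thesis by simp
  qed
  ultimately show False by simp
qed

section \<open>From uniform exponential stability to the integral bound\<close>

text \<open>The exponent \<open>p = 1\<close> suffices: the orbit is dominated by
  \<open>D * norm x * exp (- r * t)\<close>, whose integral gives the constant
  \<open>D / r\<close>.\<close>

lemma uniformly_exp_stable_imp_datko:
  assumes "uniformly_exp_stable A"
  obtains c where "c > 0"
    "\<And>q x. set_integrable lborel {0..} (\<lambda>t. norm (blinfun_apply (A q t) x))"
    "\<And>q x. (LINT t:{0..}|lborel. norm (blinfun_apply (A q t) x)) \<le> c * norm x"
proof -
  obtain D r where D: "D > 0" "r > 0" "\<And>q t. t \<ge> 0 \<Longrightarrow> norm (A q t) \<le> D * exp (- r * t)"
    using assms unfolding uniformly_exp_stable_def by blast
  have hb: "has_bochner_integral lborel (\<lambda>t. indicator {0..} t *\<^sub>R exp (- r * t)) (1 / r)"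
  proof (rule has_bochner_integral_nn_integral)
    have "(\<integral>\<^sup>+t. ennreal (exp (- r * t)) * indicator {0..} t \<partial>lborel) = ennreal (0 - (- exp (- r * 0) / r))"
    proof (rule nn_integral_FTC_atLeast)
      show "((\<lambda>t. - exp (- r * t) / r) has_real_derivative exp (- r * t)) (at t)" for t
        using D(2) by (auto intro!: derivative_eq_intros)
      show "((\<lambda>t. - exp (- r * t) / r) \<longlongrightarrow> 0) at_top"
        using D(2) by real_asymp
    qed auto
    moreover have "ennreal (indicator {0..} t *\<^sub>R exp (- r * t)) = ennreal (exp (- r * t)) * indicator {0..} t" for t
      by (auto simp: indicator_def)
    ultimately show "(\<integral>\<^sup>+t. ennreal (indicator {0..} t *\<^sub>R exp (- r * t)) \<partial>lborel) = ennreal (1 / r)"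
      by simp
  qed (use D(2) in auto)
  have bound: "norm (blinfun_apply (A q t) x) \<le> D * norm x * exp (- r * t)" if "t \<ge> 0" for q t x
  proof -
    have "norm (blinfun_apply (A q t) x) \<le> norm (A q t) * norm x" by (rule norm_blinfun)
    also have "\<dots> \<le> (D * exp (- r * t)) * norm x" by (intro mult_right_mono D that) auto
    finally show ?thesis by (simp add: mult_ac)
  qed
  have dom: "integrable lborel (\<lambda>t. indicator {0..} t *\<^sub>R (D * norm x * exp (- r * t)))" for x :: 'x
    using integrable_mult_left[OF integrable.intros[OF hb], of "D * norm x"] by (simp add: mult_ac)
  have int: "integrable lborel (\<lambda>t. indicator {0..} t *\<^sub>R norm (blinfun_apply (A q t) x))" for q x
  proof (rule Bochner_Integration.integrable_bound[OF dom])
    have "continuous_on {0..} (\<lambda>t. norm (blinfun_apply (A q t) x))"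
      using A_continuous_time[of q] by (intro continuous_intros)
    then show "(\<lambda>t. indicator {0..} t *\<^sub>R norm (blinfun_apply (A q t) x)) \<in> borel_measurable lborel"
      using borel_measurable_continuous_on_indicator[of "{0..}" "\<lambda>t. norm (blinfun_apply (A q t) x)"] by simp
  qed (use bound in \<open>auto simp: indicator_def intro!: AE_I2 order_trans[OF _ abs_ge_self]\<close>)
  have "(LINT t:{0..}|lborel. norm (blinfun_apply (A q t) x)) \<le> D / r * norm x" for q x
  proof -
    have "(LINT t:{0..}|lborel. norm (blinfun_apply (A q t) x))
        \<le> (LINT t|lborel. indicator {0..} t *\<^sub>R (D * norm x * exp (- r * t)))"
      unfolding set_lebesgue_integral_def
      by (intro integral_mono int dom) (use bound in \<open>auto simp: indicator_def\<close>)
    also have "\<dots> = D * norm x * (LINT t|lborel. indicator {0..} t *\<^sub>R exp (- r * t))"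
      by (simp add: mult_ac flip: integral_mult_right_zero)
    finally show ?thesis using has_bochner_integral_integral_eq[OF hb] by simp
  qed
  then show thesis using D int by (intro that[of "D / r"]) (auto simp: set_integrable_def)
qed

end

text \<open>A Bochner integral is 0 by convention when the integrand is not integrable, so
  finiteness of the integral has to be a separate conjunct.\<close>

theorem theorem5:
  fixes \<phi> :: "real \<Rightarrow> 'm::metric_space \<Rightarrow> 'm"
    and A :: "'m \<Rightarrow> real \<Rightarrow> ('x::banach \<Rightarrow>\<^sub>L 'x)"
  assumes "compact (UNIV :: 'm set)"
    and "separable_space (euclidean :: 'x topology)"
    and "semiflow \<phi>"
    and "continuous_cocycle \<phi> A"
  shows "(\<exists>C :: 'm \<Rightarrow> real. \<exists>E :: 'm set. \<exists>p :: real.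
            C \<in> borel_measurable borel \<and> (\<forall>q. C q > 0) \<and> full_measure \<phi> E \<and> p > 0 \<and>
            (\<forall>q\<in>E. \<forall>x :: 'x.
               set_integrable lborel {0..} (\<lambda>t. norm (blinfun_apply (A q t) x) powr p) \<and>
               (LINT t:{0..}|lborel. norm (blinfun_apply (A q t) x) powr p) powr (1 / p)
                 \<le> C q * norm x))
         \<longleftrightarrow> uniformly_exp_stable A" (is "?datko \<longleftrightarrow> _")
proof -
  interpret compact_cocycle \<phi> A by unfold_locales (fact assms)+
  show ?thesis
  proof
    assume ?datko
    then obtain C E p where "C \<in> borel_measurable borel" "\<And>q. C q > 0" "full_measure \<phi> E" "p > 0"
      "\<And>q x. q \<in> E \<Longrightarrow> set_integrable lborel {0..} (\<lambda>t. norm (blinfun_apply (A q t) x) powr p)"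
      "\<And>q x. q \<in> E \<Longrightarrow>
        (LINT t:{0..}|lborel. norm (blinfun_apply (A q t) x) powr p) powr (1 / p) \<le> C q * norm x"
      by blast
    then show "uniformly_exp_stable A" by (rule datko_imp_uniformly_exp_stable)
  next
    assume "uniformly_exp_stable A"
    then obtain c where c: "c > 0"
      "\<And>q x. set_integrable lborel {0..} (\<lambda>t. norm (blinfun_apply (A q t) x))"
      "\<And>q x. (LINT t:{0..}|lborel. norm (blinfun_apply (A q t) x)) \<le> c * norm x"
      using uniformly_exp_stable_imp_datko by blast
    have "full_measure \<phi> UNIV"
      using prob_space.emeasure_space_1 borel_probsD invariant_borel_probs
      by (force simp: full_measure_def ergodic_measures_def)
    \<comment> \<open>Nonnegativity of the integral is what allows \<open>powr (1 / 1)\<close> to be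
      dropped for the witness \<open>p = 1\<close>.\<close>
    moreover have "(LINT t:{0..}|lborel. norm (blinfun_apply (A q t) x)) \<ge> 0" for q x
      unfolding set_lebesgue_integral_def
      by (intro Bochner_Integration.integral_nonneg) (auto simp: indicator_def)
    ultimately show ?datko
      using c by (intro exI[of _ "\<lambda>_. c"] exI[of _ UNIV] exI[of _ 1]) auto
  qed
qed

end
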